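(* Let $1 \leq p \leq \infty$. In the setting described in the context, assume $\xi\equiv 0$ (so $Z=Y=W\circ T$), $b \in C_b(\mathbb{R}^d;\mathbb{R}^d)$, and that there exists $\delta>0$ such that \[ \int_0^\delta \mathbb{E}\, T_s^{-\frac12-\frac{d}{2p}}\,ds < \infty \] (with $d/p=0$ when $p=\infty$). Then for every $t>0$ and every $f \in L_p(\mathbb{R}^d)$ one has $P^X_t f \in C_b(\mathbb{R}^d)$, where $P^X_t f(x) = \mathbb{E} f(X^x_t)$ is computed with a Borel representative of $f$.
   Context: $W$ is a standard $\mathbb{R}^d$-valued Wiener process (identity covariance). A subordinator is an increasing Lévy process $T:\mathbb{R}_+\to\mathbb{R}_+$ with $T_0=0$ and $T_t>0$ for $t>0$; $T$ is independent of $W$, and $Y_t := W_{T_t}$. $\xi$ is an $\mathbb{R}^d$-valued Lévy process independent of $Y$, and $Z := Y+\xi$. $b:\mathbb{R}^d\to\mathbb{R}^d$ is continuous. Standing assumption: for each $x\in\mathbb{R}^d$ the SDE $dX_t=b(X_t)\,dt+dZ_t$, $X_0=x$, has a Markovian weak solution $X^x$, and the transition semigroup $P^X_t f(x) := \mathbb{E} f(X^x_t)$ is Feller for all $t\geq 0$, i.e. $P^X_t$ maps $C_b(\mathbb{R}^d)$ (bounded continuous functions) into $C_b(\mathbb{R}^d)$. *)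

theory Defs
  imports "HOL-Probability.Probability" "HOL-Probability.Conditional_Expectation"
begin

definition gauss_vec :: "real \<Rightarrow> (real ^ 'd::finite) measure" where
  "gauss_vec c = density lborel
     (\<lambda>x. ennreal ((2 * pi * c) powr (- real CARD('d) / 2) * exp (- (norm x)\<^sup>2 / (2 * c))))"

definition indep_increments :: "'a measure \<Rightarrow> (real \<Rightarrow> 'a \<Rightarrow> 'b::{real_normed_vector,second_countable_topology}) \<Rightarrow> bool" where
  "indep_increments M Y \<longleftrightarrow>
     (\<forall>(n::nat) (ts::nat \<Rightarrow> real). 0 \<le> ts 0 \<and> (\<forall>i<n. ts i < ts (Suc i)) \<longrightarrow>
        prob_space.indep_vars M (\<lambda>_. borel) (\<lambda>i \<omega>. Y (ts (Suc i)) \<omega> - Y (ts i) \<omega>) {..<n})"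

definition wiener_process :: "'a measure \<Rightarrow> (real \<Rightarrow> 'a \<Rightarrow> real ^ 'd::finite) \<Rightarrow> bool" where
  "wiener_process M W \<longleftrightarrow> prob_space M \<and>
     (\<forall>t. W t \<in> borel_measurable M) \<and>
     (\<forall>\<omega>\<in>space M. W 0 \<omega> = 0 \<and> continuous_on {0..} (\<lambda>t. W t \<omega>)) \<and>
     (\<forall>s t. 0 \<le> s \<and> s < t \<longrightarrow> distr M borel (\<lambda>\<omega>. W t \<omega> - W s \<omega>) = gauss_vec (t - s)) \<and>
     indep_increments M W"

definition subordinator :: "'a measure \<Rightarrow> (real \<Rightarrow> 'a \<Rightarrow> real) \<Rightarrow> bool" where
  "subordinator M T \<longleftrightarrow> prob_space M \<and>
     (\<forall>t. T t \<in> borel_measurable M) \<and>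
     (\<forall>\<omega>\<in>space M. T 0 \<omega> = 0 \<and> mono_on {0..} (\<lambda>t. T t \<omega>) \<and>
        (\<forall>t>0. T t \<omega> > 0) \<and>
        (\<forall>t\<ge>0. continuous (at_right t) (\<lambda>s. T s \<omega>)) \<and>
        (\<forall>t>0. \<exists>l. ((\<lambda>s. T s \<omega>) \<longlongrightarrow> l) (at_left t))) \<and>
     (\<forall>s t. 0 \<le> s \<and> 0 \<le> t \<longrightarrow> distr M borel (\<lambda>\<omega>. T (s + t) \<omega> - T s \<omega>) = distr M borel (T t)) \<and>
     indep_increments M T"

definition same_fdd :: "'a measure \<Rightarrow> (real \<Rightarrow> 'a \<Rightarrow> real) \<Rightarrow> 'b measure \<Rightarrow> (real \<Rightarrow> 'b \<Rightarrow> real) \<Rightarrow> bool" where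
  "same_fdd M T N S \<longleftrightarrow>
     (\<forall>(n::nat) (ts::nat \<Rightarrow> real). (\<forall>i<n. 0 \<le> ts i) \<longrightarrow>
        distr M (PiM {..<n} (\<lambda>_. borel)) (\<lambda>\<omega>. \<lambda>i\<in>{..<n}. T (ts i) \<omega>)
        = distr N (PiM {..<n} (\<lambda>_. borel)) (\<lambda>\<omega>. \<lambda>i\<in>{..<n}. S (ts i) \<omega>))"

definition nat_filtration :: "'a measure \<Rightarrow> (real \<Rightarrow> 'a \<Rightarrow> 'b::topological_space) \<Rightarrow> real \<Rightarrow> 'a measure" where
  "nat_filtration M X s = sigma (space M)
     {X r -` A \<inter> space M | r A. 0 \<le> r \<and> r \<le> s \<and> A \<in> sets borel}"

definition proc_sigma :: "'a measure \<Rightarrow> (real \<Rightarrow> 'a \<Rightarrow> 'b::topological_space) \<Rightarrow> 'a set set" where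
  "proc_sigma M Y = sigma_sets (space M) {Y t -` A \<inter> space M | t A. 0 \<le> t \<and> A \<in> sets borel}"

definition trans_sg :: "('x \<Rightarrow> 'a measure) \<Rightarrow> ('x \<Rightarrow> real \<Rightarrow> 'a \<Rightarrow> 'x) \<Rightarrow> real \<Rightarrow> ('x \<Rightarrow> real) \<Rightarrow> 'x \<Rightarrow> real" where
  "trans_sg M X t f x = (\<integral>\<omega>. f (X x t \<omega>) \<partial>M x)"

definition Lp_fun :: "ennreal \<Rightarrow> (real ^ 'd::finite \<Rightarrow> real) \<Rightarrow> bool" where
  "Lp_fun p f \<longleftrightarrow> f \<in> borel_measurable lborel \<and>
     (if p = \<top> then (\<exists>C. AE x in lborel. \<bar>f x\<bar> \<le> C)
      else (\<integral>\<^sup>+ x. ennreal (\<bar>f x\<bar> powr enn2real p) \<partial>lborel) < \<top>)"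

definition d_over_p :: "nat \<Rightarrow> ennreal \<Rightarrow> real" where
  "d_over_p d p = (if p = \<top> then 0 else real d / enn2real p)"

end

theory Submission
  imports Defs
begin

text \<open>
  Let \<open>Q\<^sub>t f(x) = E f(x + W\<^sub>T\<^sub>(\<^sub>t\<^sub>))\<close> be the semigroup of the noise and \<open>P\<^sub>t\<close> that of the solution.
  Over a time step \<open>h\<close> the drift moves the solution by at most \<open>h * sup |b|\<close>, hence
  \<open>|P\<^sub>h g - Q\<^sub>h g| \<le> h * sup |b| * Lip g\<close>. From
  \<open>P\<^sub>h\<^sub>+\<^sub>s f - Q\<^sub>h\<^sub>+\<^sub>s f = P\<^sub>h (P\<^sub>s f - Q\<^sub>s f) + (P\<^sub>h - Q\<^sub>h) Q\<^sub>s f\<close> and the gradient bound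
  \<open>Lip (Q\<^sub>s f) \<le> c * \<phi>(s) * |f|\<^sub>p\<close>, where \<open>\<phi>(s) = 1 + E T(s) powr (- 1/2 - d/(2p))\<close> is decreasing,
  iteration with \<open>h = t/n\<close> gives \<open>|P\<^sub>t f - Q\<^sub>t f| \<le> |P\<^sub>h f - Q\<^sub>h f| + c * sup |b| * |f|\<^sub>p * F(t)\<close>,
  where \<open>F\<close> is the integral of \<open>\<phi>\<close> over \<open>(0, t]\<close>.

  For Lipschitz \<open>f\<close> the first term vanishes as \<open>n\<close> grows. The case \<open>p = \<infinity>\<close> thus bounds the total
  variation distance of the two transition kernels by a multiple of \<open>F(t)\<close>. Consequently \<open>P\<^sub>t f\<close> is,
  for bounded Borel \<open>f\<close>, the uniform limit of the functions \<open>P\<^sub>t\<^sub>-\<^sub>s (Q\<^sub>s f)\<close> as \<open>s\<close> tends to \<open>0\<close>, which are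
  continuous by the Feller property. The total variation bound also makes the first term vanish for
  all bounded Borel \<open>f\<close>, so that \<open>|P\<^sub>t f| \<le> D(t) * |f|\<^sub>p\<close>, and truncation of \<open>f \<in> L\<^sub>p\<close> finishes the proof.
\<close>

section \<open>Bounded Borel functions\<close>

definition bounded_borel :: "real \<Rightarrow> ('a::topological_space \<Rightarrow> real) \<Rightarrow> bool" where
  "bounded_borel m f \<longleftrightarrow> f \<in> borel_measurable borel \<and> (\<forall>x. \<bar>f x\<bar> \<le> m)"

lemma bounded_borelI: "f \<in> borel_measurable borel \<Longrightarrow> (\<And>x. \<bar>f x\<bar> \<le> m) \<Longrightarrow> bounded_borel m f"
  by (simp add: bounded_borel_def)

lemma bounded_borel_measurable: "bounded_borel m f \<Longrightarrow> f \<in> borel_measurable borel"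
  by (simp add: bounded_borel_def)

lemma bounded_borel_le: "bounded_borel m f \<Longrightarrow> \<bar>f x\<bar> \<le> m"
  by (simp add: bounded_borel_def)

lemma bounded_borel_nonneg: "bounded_borel m f \<Longrightarrow> 0 \<le> m"
  using bounded_borel_le[of m f undefined] by linarith

lemma bounded_borel_bounded: "bounded_borel m f \<Longrightarrow> bounded (range f)"
  by (auto simp: bounded_borel_def bounded_iff)

lemma bounded_borel_shift:
  fixes f :: "'a::{second_countable_topology, real_normed_vector} \<Rightarrow> real"
  shows "bounded_borel m f \<Longrightarrow> bounded_borel m (\<lambda>y. f (x + y))"
  by (auto simp: bounded_borel_def intro: measurable_compose[of "(+) x", rotated])

lemma (in prob_space) integrable_bounded_borel:
  "bounded_borel m f \<Longrightarrow> X \<in> borel_measurable M \<Longrightarrow> integrable M (\<lambda>\<omega>. f (X \<omega>))"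
  by (auto simp: bounded_borel_def intro!: integrable_const_bound[of _ m])

lemma (in prob_space) abs_integral_diff_le:
  fixes f g :: "'a \<Rightarrow> real"
  assumes "integrable M f" "integrable M g" "AE x in M. \<bar>f x - g x\<bar> \<le> K"
  shows "\<bar>(\<integral> x. f x \<partial>M) - (\<integral> x. g x \<partial>M)\<bar> \<le> K"
proof -
  have "\<bar>(\<integral> x. f x \<partial>M) - (\<integral> x. g x \<partial>M)\<bar> = \<bar>\<integral> x. f x - g x \<partial>M\<bar>"
    using assms by simp
  also have "\<dots> \<le> (\<integral> x. \<bar>f x - g x\<bar> \<partial>M)"
    by (rule integral_abs_bound)
  also have "\<dots> \<le> K"
    using assms by (intro integral_le_const) auto
  finally show ?thesis .
qed

lemma (in prob_space) abs_integral_bounded_borel_le: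
  assumes "bounded_borel m f" "X \<in> borel_measurable M"
  shows "\<bar>\<integral> \<omega>. f (X \<omega>) \<partial>M\<bar> \<le> m"
  using abs_integral_diff_le[OF integrable_bounded_borel[OF assms], of "\<lambda>_. 0" m] bounded_borel_le[OF assms(1)]
  by simp

lemma measure_eqI_nn_integral:
  assumes sets_eq: "sets M = sets N"
    and nn_integral_eq: "\<And>f. f \<in> borel_measurable N \<Longrightarrow> (\<integral>\<^sup>+ x. f x \<partial>M) = (\<integral>\<^sup>+ x. f x \<partial>N)"
  shows "M = N"
proof (rule measure_eqI[OF sets_eq])
  fix A assume "A \<in> sets M"
  then show "emeasure M A = emeasure N A"
    using nn_integral_eq[of "indicator A"] by (simp add: sets_eq)
qed

section \<open>Gaussian measures\<close>

definition gauss_dens :: "real \<Rightarrow> real ^ 'd::finite \<Rightarrow> real" where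
  "gauss_dens c x = (2 * pi * c) powr (- real CARD('d) / 2) * exp (- (norm x)\<^sup>2 / (2 * c))"

lemma gauss_dens_nonneg [simp]: "0 \<le> gauss_dens c x"
  by (simp add: gauss_dens_def)

lemma gauss_dens_measurable [measurable (raw)]:
  assumes [measurable]: "g \<in> borel_measurable M" "h \<in> borel_measurable M"
  shows "(\<lambda>x. gauss_dens (g x) (h x)) \<in> borel_measurable M"
  unfolding gauss_dens_def by measurable

lemma gauss_dens_eq_prod_normal_density:
  fixes x :: "real ^ 'd::finite"
  assumes "0 < c"
  shows "gauss_dens c x = (\<Prod>b\<in>Basis. normal_density 0 (sqrt c) (x \<bullet> b))"
proof -
  have "(\<Prod>b\<in>Basis. normal_density 0 (sqrt c) (x \<bullet> b))
      = (1 / sqrt (2 * pi * c)) ^ CARD('d) * exp (\<Sum>b\<in>Basis. - (x \<bullet> b)\<^sup>2 / (2 * c))"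
    using assms by (simp add: normal_density_def prod.distrib prod_dividef exp_sum power_divide)
  also have "(\<Sum>b\<in>Basis. - (x \<bullet> b)\<^sup>2 / (2 * c)) = - (norm x)\<^sup>2 / (2 * c)"
    unfolding power2_norm_eq_inner euclidean_inner[of x x]
    by (simp add: power2_eq_square sum_negf sum_divide_distrib)
  also have "1 / sqrt (2 * pi * c) = (2 * pi * c) powr (- 1 / 2)"
    using assms by (simp add: powr_minus_divide powr_half_sqrt)
  also have "\<dots> ^ CARD('d) = (2 * pi * c) powr (- real CARD('d) / 2)"
    using assms by (simp add: powr_powr flip: powr_realpow)
  finally show ?thesis
    by (simp add: gauss_dens_def)
qed

lemma gauss_vec_eq_density: "gauss_vec c = density lborel (\<lambda>x. ennreal (gauss_dens c x))"
  by (simp add: gauss_vec_def gauss_dens_def)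

lemma sets_gauss_vec [simp, measurable_cong]: "sets (gauss_vec c) = sets borel"
  by (simp add: gauss_vec_eq_density)

lemma space_gauss_vec [simp]: "space (gauss_vec c) = UNIV"
  by (simp add: gauss_vec_eq_density)

lemma distr_gauss_vec_shift:
  fixes x :: "real ^ 'd::finite"
  shows "distr (gauss_vec r) borel ((+) x) = density lborel (\<lambda>z. ennreal (gauss_dens r (z - x)))"
  using density_distr[of "\<lambda>z. ennreal (gauss_dens r (z - x))" borel "(+) x" lborel]
  by (simp add: lborel_distr_plus gauss_vec_eq_density)

lemma nn_integral_gauss_vec_shift:
  fixes f :: "real ^ 'd::finite \<Rightarrow> ennreal"
  assumes [measurable]: "f \<in> borel_measurable borel"
  shows "(\<integral>\<^sup>+ w. f (x + w) \<partial>gauss_vec r) = (\<integral>\<^sup>+ z. ennreal (gauss_dens r (z - x)) * f z \<partial>lborel)"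
  using nn_integral_distr[of "(+) x" "gauss_vec r" borel f]
  by (simp add: distr_gauss_vec_shift nn_integral_density)

lemma integral_gauss_vec_shift:
  fixes f :: "real ^ 'd::finite \<Rightarrow> real"
  assumes [measurable]: "f \<in> borel_measurable borel"
  shows "(\<integral> w. f (x + w) \<partial>gauss_vec r) = (\<integral> z. gauss_dens r (z - x) * f z \<partial>lborel)"
  using integral_distr[of "(+) x" "gauss_vec r" borel f]
  by (simp add: distr_gauss_vec_shift integral_density)

lemma integrable_gauss_vec_shift_iff:
  fixes f :: "real ^ 'd::finite \<Rightarrow> real"
  assumes [measurable]: "f \<in> borel_measurable borel"
  shows "integrable (gauss_vec r) (\<lambda>w. f (x + w)) \<longleftrightarrow> integrable lborel (\<lambda>z. gauss_dens r (z - x) * f z)"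
  using integrable_distr_eq[of "(+) x" "gauss_vec r" borel f]
  by (simp add: distr_gauss_vec_shift integrable_density)

lemma prob_space_gauss_vec:
  assumes "0 < c"
  shows "prob_space (gauss_vec c :: (real ^ 'd::finite) measure)"
proof
  have "emeasure (gauss_vec c :: (real ^ 'd) measure) UNIV
      = (\<integral>\<^sup>+ x. (\<Prod>b\<in>Basis. ennreal (normal_density 0 (sqrt c) (x \<bullet> b))) \<partial>(lborel :: (real ^ 'd) measure))"
    using assms
    by (simp add: gauss_vec_eq_density emeasure_density gauss_dens_eq_prod_normal_density prod_ennreal
        normal_density_nonneg)
  also have "\<dots> = (\<Prod>b\<in>(Basis :: (real ^ 'd) set). \<integral>\<^sup>+ u. ennreal (normal_density 0 (sqrt c) u) \<partial>lborel)"
    by (rule nn_integral_lborel_prod) simp_all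
  also have "\<dots> = 1"
    using assms prob_space.emeasure_space_1[OF prob_space_normal_density[of "sqrt c" 0]]
    by (simp add: emeasure_density)
  finally show "emeasure (gauss_vec c :: (real ^ 'd) measure) (space (gauss_vec c)) = 1"
    by simp
qed

lemma nn_integral_gauss_dens_convolution:
  fixes x :: "real ^ 'd::finite"
  assumes "0 < a" "0 < b"
  shows "(\<integral>\<^sup>+ y. ennreal (gauss_dens a (x - y) * gauss_dens b y) \<partial>lborel) = ennreal (gauss_dens (a + b) x)"
proof -
  let ?n = "normal_density 0"
  have "(\<integral>\<^sup>+ y. ennreal (gauss_dens a (x - y) * gauss_dens b y) \<partial>lborel)
      = (\<integral>\<^sup>+ y. (\<Prod>i\<in>Basis. ennreal (?n (sqrt a) (x \<bullet> i - y \<bullet> i) * ?n (sqrt b) (y \<bullet> i))) \<partial>lborel)"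
    using assms
    by (simp add: gauss_dens_eq_prod_normal_density inner_diff_left prod_ennreal normal_density_nonneg
        flip: prod.distrib)
  also have "\<dots> = (\<Prod>i\<in>Basis. \<integral>\<^sup>+ u. ennreal (?n (sqrt a) (x \<bullet> i - u) * ?n (sqrt b) u) \<partial>lborel)"
    by (rule nn_integral_lborel_prod) simp_all
  also have "\<dots> = (\<Prod>i\<in>Basis. ennreal (?n (sqrt (a + b)) (x \<bullet> i)))"
    using conv_normal_density_zero_mean[of "sqrt a" "sqrt b"] assms by (simp add: fun_eq_iff)
  also have "\<dots> = ennreal (gauss_dens (a + b) x)"
    using assms by (simp add: gauss_dens_eq_prod_normal_density prod_ennreal normal_density_nonneg)
  finally show ?thesis .
qed

lemma gauss_vec_add:
  fixes a b :: real
  assumes "0 < a" "0 < b"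
  shows "gauss_vec (a + b) = (gauss_vec a \<star> gauss_vec b :: (real ^ 'd::finite) measure)"
proof (rule measure_eqI_nn_integral)
  interpret A: prob_space "gauss_vec a :: (real ^ 'd) measure" by (rule prob_space_gauss_vec) fact
  interpret B: prob_space "gauss_vec b :: (real ^ 'd) measure" by (rule prob_space_gauss_vec) fact
  note finite = A.finite_measure_axioms B.finite_measure_axioms
  fix f :: "real ^ 'd \<Rightarrow> ennreal" assume "f \<in> borel_measurable (gauss_vec a \<star> gauss_vec b)"
  then have [measurable]: "f \<in> borel_measurable borel" by simp
  have "(\<integral>\<^sup>+ w. f w \<partial>(gauss_vec a \<star> gauss_vec b)) = (\<integral>\<^sup>+ y. \<integral>\<^sup>+ w. f (y + w) \<partial>gauss_vec a \<partial>gauss_vec b)"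
    by (subst convolution_commutative) (simp_all add: nn_integral_convolution finite)
  also have "\<dots> = (\<integral>\<^sup>+ y. \<integral>\<^sup>+ z. ennreal (gauss_dens a (z - y)) * f z \<partial>lborel \<partial>gauss_vec b)"
    by (simp add: nn_integral_gauss_vec_shift)
  also have "\<dots> = (\<integral>\<^sup>+ y. \<integral>\<^sup>+ z. ennreal (gauss_dens a (z - y) * gauss_dens b y) * f z \<partial>lborel \<partial>lborel)"
    unfolding gauss_vec_eq_density
    by (subst nn_integral_density) (auto simp: ennreal_mult mult_ac nn_integral_cmult[symmetric])
  also have "\<dots> = (\<integral>\<^sup>+ z. (\<integral>\<^sup>+ y. ennreal (gauss_dens a (z - y) * gauss_dens b y) \<partial>lborel) * f z \<partial>lborel)"
    by (subst lborel_pair.Fubini') (auto simp: nn_integral_multc)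
  also have "\<dots> = (\<integral>\<^sup>+ w. f w \<partial>gauss_vec (a + b))"
    using assms by (simp add: nn_integral_gauss_dens_convolution gauss_vec_eq_density nn_integral_density)
  finally show "(\<integral>\<^sup>+ w. f w \<partial>gauss_vec (a + b)) = (\<integral>\<^sup>+ w. f w \<partial>(gauss_vec a \<star> gauss_vec b))" ..
qed simp

lemma nn_integral_gauss_vec_measurable [measurable]:
  fixes f :: "real ^ 'd::finite \<Rightarrow> ennreal"
  assumes [measurable]: "f \<in> borel_measurable borel"
  shows "(\<lambda>r. \<integral>\<^sup>+ w. f w \<partial>gauss_vec r) \<in> borel_measurable borel"
  by (simp add: gauss_vec_eq_density nn_integral_density)

abbreviation borel_pos :: "real measure" where
  "borel_pos \<equiv> restrict_space borel {0<..}"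

lemma gauss_vec_measurable:
  "gauss_vec \<in> borel_pos \<rightarrow>\<^sub>M (prob_algebra borel :: (real ^ 'd::finite) measure measure)"
proof (rule measurable_prob_algebraI)
  show prob: "prob_space (gauss_vec r :: (real ^ 'd) measure)" if "r \<in> space borel_pos" for r
    using that by (intro prob_space_gauss_vec) (simp add: space_restrict_space)
  show "gauss_vec \<in> borel_pos \<rightarrow>\<^sub>M (subprob_algebra borel :: (real ^ 'd) measure measure)"
  proof (rule measurable_subprob_algebra)
    fix A :: "(real ^ 'd) set" assume "A \<in> sets borel"
    then show "(\<lambda>r. emeasure (gauss_vec r) A) \<in> borel_measurable borel_pos"
      using nn_integral_gauss_vec_measurable[of "indicator A"] by (intro measurable_restrict_space1) simp
  qed (use prob in \<open>auto intro: prob_space_imp_subprob_space\<close>)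
qed

lemma exp_neg_square_diff_le:
  fixes a b :: real
  assumes "0 \<le> a" "0 \<le> b"
  shows "\<bar>exp (- a\<^sup>2 / 2) - exp (- b\<^sup>2 / 2)\<bar> \<le> \<bar>a - b\<bar> * (exp (- a\<^sup>2 / 4) + exp (- b\<^sup>2 / 4))"
  using assms
proof (induction a b rule: linorder_wlog)
  case (le a b)
  show ?case
  proof (cases "a = b")
    case False
    with le have "a < b" by simp
    have "((\<lambda>x. exp (- x\<^sup>2 / 2)) has_real_derivative (- x * exp (- x\<^sup>2 / 2))) (at x)" for x :: real
      by (auto intro!: derivative_eq_intros)
    with MVT2[OF \<open>a < b\<close>, of "\<lambda>x. exp (- x\<^sup>2 / 2)" "\<lambda>x. - x * exp (- x\<^sup>2 / 2)"]
    obtain z where z: "a < z" "z < b"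
      and mvt: "exp (- b\<^sup>2 / 2) - exp (- a\<^sup>2 / 2) = (b - a) * (- z * exp (- z\<^sup>2 / 2))"
      by blast
    have "z \<le> 1 + z\<^sup>2 / 4"
      using zero_le_power2[of "z / 2 - 1"] by (simp add: power2_eq_square field_simps)
    also have "\<dots> \<le> exp (z\<^sup>2 / 4)" by (rule exp_ge_add_one_self)
    finally have "z * exp (- z\<^sup>2 / 2) \<le> exp (z\<^sup>2 / 4) * exp (- z\<^sup>2 / 2)"
      by (intro mult_right_mono) auto
    also have "\<dots> = exp (- z\<^sup>2 / 4)" by (simp flip: exp_add)
    also have "\<dots> \<le> exp (- a\<^sup>2 / 4)"
      using le z by (simp add: power_mono)
    also have "\<dots> \<le> exp (- a\<^sup>2 / 4) + exp (- b\<^sup>2 / 4)" by simp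
    finally have bound: "z * exp (- z\<^sup>2 / 2) \<le> exp (- a\<^sup>2 / 4) + exp (- b\<^sup>2 / 4)" .
    have "\<bar>exp (- a\<^sup>2 / 2) - exp (- b\<^sup>2 / 2)\<bar> = exp (- a\<^sup>2 / 2) - exp (- b\<^sup>2 / 2)"
      using le by (simp add: power_mono)
    also have "\<dots> = (b - a) * (z * exp (- z\<^sup>2 / 2))"
      using mvt by simp
    also have "\<dots> \<le> \<bar>a - b\<bar> * (exp (- a\<^sup>2 / 4) + exp (- b\<^sup>2 / 4))"
      using \<open>a < b\<close> le z bound by (intro mult_mono) auto
    finally show ?thesis .
  qed simp
qed (simp add: abs_minus_commute add.commute)

lemma gauss_dens_diff_le:
  fixes u v :: "real ^ 'd::finite"
  assumes "0 < r"
  shows "\<bar>gauss_dens r u - gauss_dens r v\<bar>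
    \<le> 2 powr (real CARD('d) / 2) * r powr (- 1/2) * norm (u - v)
      * (gauss_dens (2 * r) u + gauss_dens (2 * r) v)"
proof -
  define C where "C = (2 * pi * r) powr (- real CARD('d) / 2)"
  define s where "s x = norm x / sqrt r" for x :: "real ^ 'd"
  have "0 \<le> C" by (simp add: C_def)
  have dens: "gauss_dens r x = C * exp (- (s x)\<^sup>2 / 2)" for x
    using assms by (simp add: gauss_dens_def C_def s_def power_divide mult.commute)
  have "(2 * pi * (2 * r)) powr (- real CARD('d) / 2) = 2 powr (- real CARD('d) / 2) * C"
    unfolding C_def using assms powr_mult[of 2 "2 * pi * r"] by (simp add: mult_ac)
  then have dens_double: "C * exp (- (s x)\<^sup>2 / 4) = 2 powr (real CARD('d) / 2) * gauss_dens (2 * r) x" for x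
    using assms by (simp add: gauss_dens_def s_def power_divide powr_minus mult.commute)
  have "\<bar>s u - s v\<bar> \<le> r powr (- 1/2) * norm (u - v)"
    using assms norm_triangle_ineq3[of u v] powr_minus_divide[of r "1/2"]
    by (simp add: s_def powr_half_sqrt divide_right_mono flip: diff_divide_distrib)
  then have "\<bar>s u - s v\<bar> * (exp (- (s u)\<^sup>2 / 4) + exp (- (s v)\<^sup>2 / 4))
      \<le> r powr (- 1/2) * norm (u - v) * (exp (- (s u)\<^sup>2 / 4) + exp (- (s v)\<^sup>2 / 4))"
    by (intro mult_right_mono) (auto intro: add_nonneg_nonneg)
  with exp_neg_square_diff_le[of "s u" "s v"] \<open>0 < r\<close>
  have "\<bar>exp (- (s u)\<^sup>2 / 2) - exp (- (s v)\<^sup>2 / 2)\<bar>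
      \<le> r powr (- 1/2) * norm (u - v) * (exp (- (s u)\<^sup>2 / 4) + exp (- (s v)\<^sup>2 / 4))"
    by (simp add: s_def)
  from mult_left_mono[OF this \<open>0 \<le> C\<close>]
  have "\<bar>gauss_dens r u - gauss_dens r v\<bar>
      \<le> r powr (- 1/2) * norm (u - v) * (C * exp (- (s u)\<^sup>2 / 4) + C * exp (- (s v)\<^sup>2 / 4))"
    using \<open>0 \<le> C\<close> by (simp add: dens abs_mult distrib_left mult_ac flip: right_diff_distrib)
  then show ?thesis
    unfolding dens_double by (simp add: algebra_simps)
qed

lemma integral_gauss_vec_diff_le:
  fixes f :: "real ^ 'd::finite \<Rightarrow> real"
  assumes [measurable]: "f \<in> borel_measurable borel" and "0 < r"
    and integrable_shift: "integrable (gauss_vec r) (\<lambda>w. f (x + w))" "integrable (gauss_vec r) (\<lambda>w. f (y + w))"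
  shows "ennreal \<bar>(\<integral> w. f (x + w) \<partial>gauss_vec r) - (\<integral> w. f (y + w) \<partial>gauss_vec r)\<bar>
    \<le> ennreal (2 powr (real CARD('d) / 2) * r powr (- 1/2) * norm (x - y))
      * ((\<integral>\<^sup>+ w. ennreal \<bar>f (x + w)\<bar> \<partial>gauss_vec (2 * r)) + (\<integral>\<^sup>+ w. ennreal \<bar>f (y + w)\<bar> \<partial>gauss_vec (2 * r)))"
    (is "_ \<le> ennreal ?K * _")
proof -
  let ?g = "\<lambda>z. gauss_dens r (z - x) * f z - gauss_dens r (z - y) * f z"
  note integrable_dens = integrable_shift[unfolded integrable_gauss_vec_shift_iff[OF assms(1)]]
  have "\<bar>?g z\<bar> \<le> ?K * (gauss_dens (2 * r) (z - x) * \<bar>f z\<bar> + gauss_dens (2 * r) (z - y) * \<bar>f z\<bar>)" for z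
    using mult_right_mono[OF gauss_dens_diff_le[OF \<open>0 < r\<close>, of "z - x" "z - y"], of "\<bar>f z\<bar>"]
    by (simp add: abs_mult norm_minus_commute distrib_left distrib_right mult.assoc flip: left_diff_distrib)
  then have integrand_le: "ennreal \<bar>?g z\<bar> \<le> ennreal ?K * (ennreal (gauss_dens (2 * r) (z - x)) * ennreal \<bar>f z\<bar>
      + ennreal (gauss_dens (2 * r) (z - y)) * ennreal \<bar>f z\<bar>)" for z
    by (simp add: ennreal_leI flip: ennreal_mult ennreal_plus)
  have "ennreal \<bar>(\<integral> w. f (x + w) \<partial>gauss_vec r) - (\<integral> w. f (y + w) \<partial>gauss_vec r)\<bar>
      = ennreal (norm (\<integral> z. ?g z \<partial>lborel))"
    using integrable_dens by (simp add: integral_gauss_vec_shift)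
  also have "\<dots> \<le> (\<integral>\<^sup>+ z. ennreal (norm (?g z)) \<partial>lborel)"
    using integrable_dens by (intro integral_norm_bound_ennreal) simp
  also have "\<dots> \<le> (\<integral>\<^sup>+ z. ennreal ?K * (ennreal (gauss_dens (2 * r) (z - x)) * ennreal \<bar>f z\<bar>
      + ennreal (gauss_dens (2 * r) (z - y)) * ennreal \<bar>f z\<bar>) \<partial>lborel)"
    using integrand_le by (intro nn_integral_mono) simp
  also have "\<dots> = ennreal ?K * ((\<integral>\<^sup>+ w. ennreal \<bar>f (x + w)\<bar> \<partial>gauss_vec (2 * r))
      + (\<integral>\<^sup>+ w. ennreal \<bar>f (y + w)\<bar> \<partial>gauss_vec (2 * r)))"
    using nn_integral_gauss_vec_shift[where f = "\<lambda>z. ennreal \<bar>f z\<bar>" and r = "2 * r"]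
    by (simp add: nn_integral_cmult nn_integral_add)
  finally show ?thesis .
qed

section \<open>Heat-bounded functions\<close>

text \<open>A function of norm \<open>N\<close> in \<open>L\<^sub>p\<close> satisfies the bound for \<open>\<kappa> = d / (2 * p)\<close>. Bounded functions satisfy
  it for every \<open>\<kappa>\<close> and Lebesgue-null functions satisfy it with \<open>N = 0\<close>, so that one notion covers all values
  of \<open>p\<close> and the passage to representatives.\<close>

definition heat_bounded :: "real \<Rightarrow> real \<Rightarrow> (real ^ 'd::finite \<Rightarrow> real) \<Rightarrow> bool" where
  "heat_bounded \<kappa> N f \<longleftrightarrow> 0 \<le> N \<and>
     (\<forall>r>0. \<forall>x. (\<integral>\<^sup>+ w. ennreal \<bar>f (x + w)\<bar> \<partial>gauss_vec r) \<le> ennreal (N * (1 + r powr (- \<kappa>))))"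

lemma heat_bounded_nonneg: "heat_bounded \<kappa> N f \<Longrightarrow> 0 \<le> N"
  by (simp add: heat_bounded_def)

lemma heat_boundedD:
  "heat_bounded \<kappa> N f \<Longrightarrow> 0 < r \<Longrightarrow> (\<integral>\<^sup>+ w. ennreal \<bar>f (x + w)\<bar> \<partial>gauss_vec r) \<le> ennreal (N * (1 + r powr (- \<kappa>)))"
  by (simp add: heat_bounded_def)

lemma heat_bounded_const:
  assumes "0 \<le> m"
  shows "heat_bounded \<kappa> m (\<lambda>_ :: real ^ 'd::finite. m)"
  using assms
  by (auto simp: heat_bounded_def distrib_left prob_space.emeasure_space_1[OF prob_space_gauss_vec, simplified]
      intro: ennreal_leI)

lemma heat_bounded_mono_AE:
  fixes f g :: "real ^ 'd::finite \<Rightarrow> real"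
  assumes f: "heat_bounded \<kappa> N f" and [measurable]: "f \<in> borel_measurable borel" "g \<in> borel_measurable borel"
    and abs_le: "AE z in lborel. \<bar>g z\<bar> \<le> \<bar>f z\<bar>"
  shows "heat_bounded \<kappa> N g"
  unfolding heat_bounded_def
proof (intro conjI allI impI)
  fix r :: real and x :: "real ^ 'd" assume "0 < r"
  have "(\<integral>\<^sup>+ w. ennreal \<bar>g (x + w)\<bar> \<partial>gauss_vec r)
      = (\<integral>\<^sup>+ z. ennreal (gauss_dens r (z - x)) * ennreal \<bar>g z\<bar> \<partial>lborel)"
    by (rule nn_integral_gauss_vec_shift) measurable
  also have "\<dots> \<le> (\<integral>\<^sup>+ z. ennreal (gauss_dens r (z - x)) * ennreal \<bar>f z\<bar> \<partial>lborel)"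
    using abs_le by (intro nn_integral_mono_AE) (auto elim!: eventually_mono intro!: mult_left_mono ennreal_leI)
  also have "\<dots> = (\<integral>\<^sup>+ w. ennreal \<bar>f (x + w)\<bar> \<partial>gauss_vec r)"
    by (rule nn_integral_gauss_vec_shift[symmetric]) measurable
  also have "\<dots> \<le> ennreal (N * (1 + r powr (- \<kappa>)))"
    by (rule heat_boundedD[OF f \<open>0 < r\<close>])
  finally show "(\<integral>\<^sup>+ w. ennreal \<bar>g (x + w)\<bar> \<partial>gauss_vec r) \<le> ennreal (N * (1 + r powr (- \<kappa>)))" .
qed (rule heat_bounded_nonneg[OF f])

lemma heat_bounded_bounded_borel:
  fixes f :: "real ^ 'd::finite \<Rightarrow> real"
  assumes "bounded_borel m f"
  shows "heat_bounded \<kappa> m f"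
  using assms bounded_borel_nonneg[OF assms]
  by (intro heat_bounded_mono_AE[OF heat_bounded_const]) (auto simp: bounded_borel_def)

lemma powr_le_one_plus_powr:
  fixes r :: real
  assumes "0 < r" "c \<le> a" "a \<le> 0"
  shows "r powr a \<le> 1 + r powr c"
proof (cases "1 \<le> r")
  case True
  then have "r powr a \<le> r powr 0" using assms by (intro powr_mono) auto
  also have "\<dots> = 1" using assms by simp
  finally show ?thesis using powr_ge_zero[of r c] by linarith
next
  case False
  then have "r powr a \<le> r powr c" using assms by (intro powr_mono') auto
  then show ?thesis by linarith
qed

lemma heat_bounded_lipschitz:
  fixes f :: "real ^ 'd::finite \<Rightarrow> real"
  assumes f [measurable]: "f \<in> borel_measurable borel" and heat_f: "heat_bounded \<kappa> N f" and "0 \<le> \<kappa>" "0 < r"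
  shows "(4 * 2 powr (real CARD('d) / 2) * N * (1 + r powr (- 1/2 - \<kappa>)))-lipschitz_on UNIV
    (\<lambda>x. \<integral> w. f (x + w) \<partial>gauss_vec r)"
proof (rule lipschitz_onI)
  fix x y :: "real ^ 'd"
  define K where "K = 2 powr (real CARD('d) / 2) * r powr (- 1/2) * norm (x - y)"
  define H where "H = N * (1 + r powr (- \<kappa>))"
  have "0 \<le> N" by (rule heat_bounded_nonneg[OF heat_f])
  then have "0 \<le> K" "0 \<le> H" by (simp_all add: K_def H_def)
  have integrable_shift: "integrable (gauss_vec r) (\<lambda>w. f (u + w))" for u
    using order_le_less_trans[OF heat_boundedD[OF heat_f \<open>0 < r\<close>, of u] ennreal_less_top]
    by (intro integrableI_bounded) auto
  have "N * (1 + (2 * r) powr - \<kappa>) \<le> H"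
    unfolding H_def using \<open>0 < r\<close> \<open>0 \<le> \<kappa>\<close> \<open>0 \<le> N\<close>
    by (intro mult_left_mono add_left_mono powr_mono2') auto
  then have double_time_le: "(\<integral>\<^sup>+ w. ennreal \<bar>f (u + w)\<bar> \<partial>gauss_vec (2 * r)) \<le> ennreal H" for u
    using heat_boundedD[OF heat_f, of "2 * r" u] \<open>0 < r\<close> by (auto intro: order_trans ennreal_leI)
  have "ennreal \<bar>(\<integral> w. f (x + w) \<partial>gauss_vec r) - (\<integral> w. f (y + w) \<partial>gauss_vec r)\<bar>
      \<le> ennreal K * (ennreal H + ennreal H)"
    unfolding K_def
    by (rule order_trans[OF integral_gauss_vec_diff_le[OF f \<open>0 < r\<close> integrable_shift integrable_shift]])
      (intro mult_left_mono add_mono double_time_le, simp)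
  then have "\<bar>(\<integral> w. f (x + w) \<partial>gauss_vec r) - (\<integral> w. f (y + w) \<partial>gauss_vec r)\<bar> \<le> K * (2 * H)"
    using \<open>0 \<le> K\<close> \<open>0 \<le> H\<close> by (simp flip: ennreal_plus ennreal_mult)
  also have "\<dots> = 2 * 2 powr (real CARD('d) / 2) * N * norm (x - y) * (r powr (- 1/2) + r powr (- 1/2 - \<kappa>))"
    unfolding powr_diff by (simp add: K_def H_def powr_minus_divide[of r \<kappa>] algebra_simps)
  also have "\<dots> \<le> 2 * 2 powr (real CARD('d) / 2) * N * norm (x - y) * (2 * (1 + r powr (- 1/2 - \<kappa>)))"
  proof (rule mult_left_mono)
    show "r powr (- 1/2) + r powr (- 1/2 - \<kappa>) \<le> 2 * (1 + r powr (- 1/2 - \<kappa>))"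
      using powr_le_one_plus_powr[of r "- 1/2 - \<kappa>" "- 1/2"] \<open>0 < r\<close> \<open>0 \<le> \<kappa>\<close> by simp
  qed (use \<open>0 \<le> N\<close> in simp)
  finally show "dist (\<integral> w. f (x + w) \<partial>gauss_vec r) (\<integral> w. f (y + w) \<partial>gauss_vec r)
      \<le> 4 * 2 powr (real CARD('d) / 2) * N * (1 + r powr (- 1/2 - \<kappa>)) * dist x y"
    by (simp add: dist_real_def dist_norm algebra_simps)
qed (use heat_bounded_nonneg[OF heat_f] in simp)

section \<open>Functions in \<open>L\<^sub>p\<close>\<close>

definition heat_regular :: "real \<Rightarrow> (real ^ 'd::finite \<Rightarrow> real) \<Rightarrow> bool" where
  "heat_regular \<kappa> f \<longleftrightarrow> f \<in> borel_measurable borel \<and>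
     (\<exists>N. N \<longlonglongrightarrow> 0 \<and> (\<forall>n. heat_bounded \<kappa> (N n) (\<lambda>y. max 0 (\<bar>f y\<bar> - real n))))"

lemma convex_on_powr:
  assumes "1 \<le> q"
  shows "convex_on {0..} (\<lambda>x :: real. x powr q)"
proof (rule convex_onI)
  fix t x y :: real assume t: "0 < t" "t < 1" and nonneg: "x \<in> {0..}" "y \<in> {0..}"
  have scale: "(s * z) powr q \<le> s * z powr q" if "0 < s" "s \<le> 1" "0 \<le> z" for s z
    using powr_mono'[of 1 q s] assms that by (simp add: powr_mult mult_right_mono)
  consider (left_zero) "x = 0" | (right_zero) "y = 0" | (pos) "0 < x" "0 < y" using nonneg by force
  then show "((1 - t) *\<^sub>R x + t *\<^sub>R y) powr q \<le> (1 - t) * x powr q + t * y powr q"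
  proof cases
    case pos
    then show ?thesis using convex_onD[OF powr_convex[OF assms], of t x y] t by simp
  qed (use scale t nonneg in auto)
qed simp

lemma convex_on_abs_powr:
  assumes "1 \<le> q"
  shows "convex_on UNIV (\<lambda>x :: real. \<bar>x\<bar> powr q)"
proof (rule convex_onI)
  fix t x y :: real assume t: "0 < t" "t < 1"
  have "\<bar>(1 - t) *\<^sub>R x + t *\<^sub>R y\<bar> \<le> (1 - t) *\<^sub>R \<bar>x\<bar> + t *\<^sub>R \<bar>y\<bar>"
    using t norm_triangle_ineq[of "(1 - t) *\<^sub>R x" "t *\<^sub>R y"] by (simp add: abs_mult)
  then have "\<bar>(1 - t) *\<^sub>R x + t *\<^sub>R y\<bar> powr q \<le> ((1 - t) *\<^sub>R \<bar>x\<bar> + t *\<^sub>R \<bar>y\<bar>) powr q"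
    using assms by (intro powr_mono2) simp_all
  also have "\<dots> \<le> (1 - t) * \<bar>x\<bar> powr q + t * \<bar>y\<bar> powr q"
    using convex_onD[OF convex_on_powr[OF assms], of t "\<bar>x\<bar>" "\<bar>y\<bar>"] t by simp
  finally show "\<bar>(1 - t) *\<^sub>R x + t *\<^sub>R y\<bar> powr q \<le> (1 - t) * \<bar>x\<bar> powr q + t * \<bar>y\<bar> powr q" .
qed simp

lemma (in prob_space)
  fixes X :: "'a \<Rightarrow> real"
  assumes "1 \<le> q" and [measurable]: "X \<in> borel_measurable M"
    and integrable_powr: "integrable M (\<lambda>\<omega>. \<bar>X \<omega>\<bar> powr q)"
  shows integrable_of_integrable_powr: "integrable M X"
    and expectation_abs_le_powr: "expectation (\<lambda>\<omega>. \<bar>X \<omega>\<bar>) \<le> expectation (\<lambda>\<omega>. \<bar>X \<omega>\<bar> powr q) powr (1 / q)"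
proof -
  have "\<bar>X \<omega>\<bar> \<le> 1 + \<bar>X \<omega>\<bar> powr q" for \<omega>
  proof (cases "1 \<le> \<bar>X \<omega>\<bar>")
    case True
    then have "\<bar>X \<omega>\<bar> powr 1 \<le> \<bar>X \<omega>\<bar> powr q" by (rule powr_mono[OF \<open>1 \<le> q\<close>])
    with True show ?thesis by simp
  next
    case False
    then show ?thesis by (simp add: add_increasing2)
  qed
  then have "AE \<omega> in M. norm (X \<omega>) \<le> norm (1 + \<bar>X \<omega>\<bar> powr q)"
    unfolding real_norm_def by (intro AE_I2 order_trans[OF _ abs_ge_self])
  then show "integrable M X"
    by (rule Bochner_Integration.integrable_bound[rotated 2]) (use integrable_powr in simp_all)
  have "\<bar>expectation (\<lambda>\<omega>. \<bar>X \<omega>\<bar>)\<bar> powr q \<le> expectation (\<lambda>\<omega>. \<bar>\<bar>X \<omega>\<bar>\<bar> powr q)"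
    by (rule jensens_inequality[of _ UNIV])
      (use \<open>integrable M X\<close> integrable_powr convex_on_abs_powr[OF \<open>1 \<le> q\<close>] in auto)
  from powr_mono2[OF _ _ this, of "1 / q"] \<open>1 \<le> q\<close>
  show "expectation (\<lambda>\<omega>. \<bar>X \<omega>\<bar>) \<le> expectation (\<lambda>\<omega>. \<bar>X \<omega>\<bar> powr q) powr (1 / q)"
    by (simp add: powr_powr)
qed

lemma gauss_dens_le:
  fixes z :: "real ^ 'd::finite"
  assumes "0 < r"
  shows "gauss_dens r z \<le> r powr (- real CARD('d) / 2)"
proof -
  have "gauss_dens r z \<le> (2 * pi * r) powr (- real CARD('d) / 2) * 1"
    unfolding gauss_dens_def using assms by (intro mult_left_mono) auto
  also have "\<dots> \<le> r powr (- real CARD('d) / 2)"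
    using assms mult_right_mono[of 1 "2 * pi" r] pi_ge_two by (simp add: powr_mono2')
  finally show ?thesis .
qed

lemma heat_bounded_Lq:
  fixes g :: "real ^ 'd::finite \<Rightarrow> real"
  assumes [measurable]: "g \<in> borel_measurable borel" and "1 \<le> q"
    and integrable_powr: "integrable lborel (\<lambda>z. \<bar>g z\<bar> powr q)"
  shows "heat_bounded (real CARD('d) / q / 2) ((\<integral> z. \<bar>g z\<bar> powr q \<partial>lborel) powr (1 / q)) g"
  unfolding heat_bounded_def
proof (intro conjI allI impI)
  fix r :: real and x :: "real ^ 'd" assume "0 < r"
  interpret prob_space "gauss_vec r :: (real ^ 'd) measure" by (rule prob_space_gauss_vec[OF \<open>0 < r\<close>])
  have g_shift: "(\<lambda>w. g (x + w)) \<in> borel_measurable (gauss_vec r)"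
    unfolding measurable_cong_sets[OF sets_gauss_vec refl] by measurable
  define J where "J = (\<integral> z. \<bar>g z\<bar> powr q \<partial>lborel)"
  have dens_powr_le: "gauss_dens r (z - x) * \<bar>g z\<bar> powr q \<le> r powr (- real CARD('d) / 2) * \<bar>g z\<bar> powr q" for z
    by (intro mult_right_mono gauss_dens_le \<open>0 < r\<close>) simp
  have integrable_dens_powr: "integrable lborel (\<lambda>z. gauss_dens r (z - x) * \<bar>g z\<bar> powr q)"
    using integrable_mult_right[OF integrable_powr, of "r powr (- real CARD('d) / 2)"]
    by (rule Bochner_Integration.integrable_bound) (use dens_powr_le in auto)
  then have "integrable (gauss_vec r) (\<lambda>w. \<bar>g (x + w)\<bar> powr q)"
    using integrable_gauss_vec_shift_iff[of "\<lambda>z. \<bar>g z\<bar> powr q"] by simp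
  note integrable_g = integrable_of_integrable_powr[OF \<open>1 \<le> q\<close> g_shift this]
    and moment_le = expectation_abs_le_powr[OF \<open>1 \<le> q\<close> g_shift this]
  have "expectation (\<lambda>w. \<bar>g (x + w)\<bar> powr q) = (\<integral> z. gauss_dens r (z - x) * \<bar>g z\<bar> powr q \<partial>lborel)"
    by (rule integral_gauss_vec_shift[where f = "\<lambda>z. \<bar>g z\<bar> powr q"]) measurable
  also have "\<dots> \<le> (\<integral> z. r powr (- real CARD('d) / 2) * \<bar>g z\<bar> powr q \<partial>lborel)"
    by (intro integral_mono integrable_dens_powr integrable_mult_right integrable_powr dens_powr_le)
  finally have "expectation (\<lambda>w. \<bar>g (x + w)\<bar> powr q) \<le> r powr (- real CARD('d) / 2) * J"
    by (simp add: J_def)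
  then have "expectation (\<lambda>w. \<bar>g (x + w)\<bar> powr q) powr (1 / q)
      \<le> (r powr (- real CARD('d) / 2) * J) powr (1 / q)"
    using \<open>1 \<le> q\<close> by (intro powr_mono2) auto
  with moment_le have "expectation (\<lambda>w. \<bar>g (x + w)\<bar>) \<le> (r powr (- real CARD('d) / 2) * J) powr (1 / q)"
    by (rule order_trans)
  also have "\<dots> = J powr (1 / q) * r powr - (real CARD('d) / q / 2)"
    by (simp add: J_def powr_mult powr_powr mult.commute)
  also have "\<dots> \<le> J powr (1 / q) * (1 + r powr - (real CARD('d) / q / 2))"
    by (intro mult_left_mono) auto
  finally have "expectation (\<lambda>w. \<bar>g (x + w)\<bar>) \<le> J powr (1 / q) * (1 + r powr - (real CARD('d) / q / 2))" .
  then show "(\<integral>\<^sup>+ w. ennreal \<bar>g (x + w)\<bar> \<partial>gauss_vec r)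
      \<le> ennreal ((\<integral> z. \<bar>g z\<bar> powr q \<partial>lborel) powr (1 / q) * (1 + r powr - (real CARD('d) / q / 2)))"
    using integrable_g by (subst nn_integral_eq_integral) (auto simp: J_def intro: ennreal_leI)
qed simp

lemma heat_regular_of_AE_bounded:
  fixes f :: "real ^ 'd::finite \<Rightarrow> real"
  assumes [measurable]: "f \<in> borel_measurable borel" and abs_le: "AE x in lborel. \<bar>f x\<bar> \<le> C"
  shows "heat_regular \<kappa> f"
  unfolding heat_regular_def
proof (intro conjI exI allI)
  show "(\<lambda>n. max 0 (C - real n)) \<longlonglongrightarrow> 0"
  proof (intro tendsto_eventually eventually_sequentiallyI[of "nat \<lceil>C\<rceil>"])
    show "max 0 (C - real n) = 0" if "nat \<lceil>C\<rceil> \<le> n" for n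
      using that by linarith
  qed
  fix n
  show "heat_bounded \<kappa> (max 0 (C - real n)) (\<lambda>y. max 0 (\<bar>f y\<bar> - real n))"
  proof (rule heat_bounded_mono_AE[OF heat_bounded_const])
    show "AE x in lborel. \<bar>max 0 (\<bar>f x\<bar> - real n)\<bar> \<le> \<bar>max 0 (C - real n)\<bar>"
      using abs_le by eventually_elim auto
  qed simp_all
qed fact

lemma heat_regular_of_Lq:
  fixes f :: "real ^ 'd::finite \<Rightarrow> real"
  assumes [measurable]: "f \<in> borel_measurable borel" and "1 \<le> q"
    and integrable_powr: "integrable lborel (\<lambda>x. \<bar>f x\<bar> powr q)"
  shows "heat_regular (real CARD('d) / q / 2) f"
proof -
  define g where "g n y = max 0 (\<bar>f y\<bar> - real n)" for n y
  define J where "J n = (\<integral> x. \<bar>g n x\<bar> powr q \<partial>lborel)" for n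
  have [measurable]: "g n \<in> borel_measurable borel" for n unfolding g_def by measurable
  have g_le: "\<bar>g n x\<bar> powr q \<le> \<bar>f x\<bar> powr q" for n x
    using \<open>1 \<le> q\<close> by (intro powr_mono2) (auto simp: g_def)
  have g_lim: "(\<lambda>n. \<bar>g n x\<bar> powr q) \<longlonglongrightarrow> 0" for x
  proof (intro tendsto_eventually eventually_sequentiallyI[of "nat \<lceil>\<bar>f x\<bar>\<rceil>"])
    show "\<bar>g n x\<bar> powr q = 0" if "nat \<lceil>\<bar>f x\<bar>\<rceil> \<le> n" for n
      using that by (simp add: g_def nat_le_iff ceiling_le_iff)
  qed
  have J_nonneg: "0 \<le> J n" for n by (simp add: J_def)
  have "J \<longlonglongrightarrow> (\<integral> x. 0 \<partial>(lborel :: (real ^ 'd) measure))"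
    unfolding J_def by (rule integral_dominated_convergence[OF _ _ integrable_powr]) (auto simp: g_le g_lim)
  then have "(\<lambda>n. J n powr (1 / q)) \<longlonglongrightarrow> 0 powr (1 / q)"
    using \<open>1 \<le> q\<close> J_nonneg by (intro tendsto_powr') (auto intro!: always_eventually)
  then have "(\<lambda>n. J n powr (1 / q)) \<longlonglongrightarrow> 0" by simp
  moreover have "heat_bounded (real CARD('d) / q / 2) (J n powr (1 / q)) (g n)" for n
    unfolding J_def using g_le \<open>1 \<le> q\<close>
    by (intro heat_bounded_Lq Bochner_Integration.integrable_bound[OF integrable_powr]) auto
  ultimately show ?thesis
    unfolding heat_regular_def g_def using assms(1) by blast
qed

lemma Lp_fun_heat_regular:
  fixes f :: "real ^ 'd::finite \<Rightarrow> real"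
  assumes "1 \<le> p" and f: "Lp_fun p f"
  shows "heat_regular (d_over_p CARD('d) p / 2) f"
proof -
  have [measurable]: "f \<in> borel_measurable borel" using f by (simp add: Lp_fun_def)
  show ?thesis
  proof (cases "p = \<top>")
    case True
    with f show ?thesis by (auto simp: Lp_fun_def intro: heat_regular_of_AE_bounded)
  next
    case False
    then have "1 \<le> enn2real p"
      using \<open>1 \<le> p\<close> enn2real_mono[of 1 p] by (simp add: top.not_eq_extremum)
    moreover have "integrable lborel (\<lambda>x. \<bar>f x\<bar> powr enn2real p)"
      using f False by (intro integrableI_nonneg) (auto simp: Lp_fun_def)
    ultimately show ?thesis
      using heat_regular_of_Lq[of f] False by (simp add: d_over_p_def)
  qed
qed

section \<open>Subordinated Brownian motion\<close>

lemma wiener_process_distr: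
  assumes W: "wiener_process M W" and "0 < r"
  shows "distr M borel (W r) = gauss_vec r"
proof -
  have "distr M borel (\<lambda>\<omega>. W r \<omega> - W 0 \<omega>) = gauss_vec (r - 0)"
    using W \<open>0 < r\<close> unfolding wiener_process_def by blast
  moreover have "distr M borel (\<lambda>\<omega>. W r \<omega> - W 0 \<omega>) = distr M borel (W r)"
    using W by (intro distr_cong) (auto simp: wiener_process_def)
  ultimately show ?thesis by simp
qed

lemma subordinator_pos: "subordinator M T \<Longrightarrow> 0 < t \<Longrightarrow> \<omega> \<in> space M \<Longrightarrow> 0 < T t \<omega>"
  by (simp add: subordinator_def)

lemma subordinator_measurable_pos:
  "subordinator M T \<Longrightarrow> 0 < t \<Longrightarrow> T t \<in> M \<rightarrow>\<^sub>M borel_pos"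
  by (auto simp: subordinator_def intro: measurable_restrict_space2)

lemma continuous_process_measurable_pair:
  fixes Y :: "real \<Rightarrow> 'a \<Rightarrow> 'b::metric_space"
  assumes Y: "\<And>t. 0 \<le> t \<Longrightarrow> Y t \<in> borel_measurable N"
    and cont: "\<And>\<omega>. \<omega> \<in> space N \<Longrightarrow> continuous_on {0..} (\<lambda>t. Y t \<omega>)"
  shows "(\<lambda>(r, \<omega>). Y r \<omega>) \<in> borel_measurable (borel_pos \<Otimes>\<^sub>M N)"
proof -
  let ?S = "borel_pos \<Otimes>\<^sub>M N"
  define g where "g i r = real (nat \<lceil>r * real (Suc i)\<rceil>) / real (Suc i)" for i :: nat and r :: real
  have "(\<lambda>(r, \<omega>). Y (g i r) \<omega>) \<in> borel_measurable ?S" for i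
  proof -
    have [measurable]: "(fst :: real \<times> 'a \<Rightarrow> real) \<in> borel_measurable ?S"
      using measurable_fst[of borel_pos N] by (simp add: measurable_restrict_space2_iff)
    have "(\<lambda>x. nat \<lceil>fst x * real (Suc i)\<rceil>) \<in> ?S \<rightarrow>\<^sub>M count_space UNIV"
      by measurable
    moreover have "(\<lambda>x. Y (real k / real (Suc i)) (snd x)) \<in> borel_measurable ?S" for k
      by (intro measurable_compose[OF measurable_snd Y]) simp
    ultimately show ?thesis
      unfolding g_def split_beta' by (rule measurable_compose_countable[rotated])
  qed
  then show ?thesis
  proof (rule borel_measurable_LIMSEQ_metric)
    fix x assume "x \<in> space ?S"
    then obtain r \<omega> where x: "x = (r, \<omega>)" and "0 < r" "\<omega> \<in> space N"
      by (auto simp: space_pair_measure space_restrict_space)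
    have g: "r \<le> g i r" "g i r \<le> r + inverse (real (Suc i))" for i
      using of_nat_ceiling[of "r * real (Suc i)"] of_int_ceiling_le_add_one[of "r * real (Suc i)"] \<open>0 < r\<close>
      by (simp_all add: g_def pos_le_divide_eq pos_divide_le_eq distrib_right del: of_nat_Suc)
    have "(\<lambda>i. g i r) \<longlonglongrightarrow> r"
    proof (rule tendsto_sandwich[of "\<lambda>_. r" _ _ "\<lambda>i. r + inverse (real (Suc i))"])
      show "(\<lambda>i. r + inverse (real (Suc i))) \<longlonglongrightarrow> r"
        using tendsto_add[OF tendsto_const LIMSEQ_inverse_real_of_nat, of r] by simp
    qed (use g in auto)
    moreover have "0 \<le> g i r" for i
      using g(1)[of i] \<open>0 < r\<close> by linarith
    ultimately have "(\<lambda>i. Y (g i r) \<omega>) \<longlonglongrightarrow> Y r \<omega>"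
      using \<open>0 < r\<close> by (intro continuous_on_tendsto_compose[OF cont[OF \<open>\<omega> \<in> space N\<close>]]) auto
    then show "(\<lambda>i. case x of (r, \<omega>) \<Rightarrow> Y (g i r) \<omega>) \<longlonglongrightarrow> (case x of (r, \<omega>) \<Rightarrow> Y r \<omega>)"
      by (simp add: x)
  qed
qed

lemma (in prob_space) distr_pair_indep_set:
  assumes ind: "indep_set \<X> \<Y>"
    and [measurable]: "X \<in> M \<rightarrow>\<^sub>M S" "Y \<in> M \<rightarrow>\<^sub>M N"
    and X: "\<And>A. A \<in> sets S \<Longrightarrow> X -` A \<inter> space M \<in> \<X>"
    and Y: "\<And>B. B \<in> sets N \<Longrightarrow> Y -` B \<inter> space M \<in> \<Y>"
  shows "distr M (S \<Otimes>\<^sub>M N) (\<lambda>\<omega>. (X \<omega>, Y \<omega>)) = distr M S X \<Otimes>\<^sub>M distr M N Y"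
proof (rule pair_measure_eqI[symmetric])
  fix A B assume "A \<in> sets (distr M S X)" "B \<in> sets (distr M N Y)"
  then have [measurable]: "A \<in> sets S" "B \<in> sets N" by auto
  have "emeasure (distr M S X) A * emeasure (distr M N Y) B
      = emeasure M ((X -` A \<inter> space M) \<inter> (Y -` B \<inter> space M))"
    using indep_setD[OF ind X Y, of A B] by (simp add: emeasure_distr emeasure_eq_measure ennreal_mult)
  also have "(X -` A \<inter> space M) \<inter> (Y -` B \<inter> space M) = (\<lambda>\<omega>. (X \<omega>, Y \<omega>)) -` (A \<times> B) \<inter> space M"
    by auto
  also have "emeasure M \<dots> = emeasure (distr M (S \<Otimes>\<^sub>M N) (\<lambda>\<omega>. (X \<omega>, Y \<omega>))) (A \<times> B)"
    by (subst emeasure_distr) auto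
  finally show "emeasure (distr M S X) A * emeasure (distr M N Y) B
      = emeasure (distr M (S \<Otimes>\<^sub>M N) (\<lambda>\<omega>. (X \<omega>, Y \<omega>))) (A \<times> B)" .
qed (auto intro!: prob_space_imp_sigma_finite prob_space_distr cong: sets_pair_measure_cong)

lemma (in prob_space) nn_integral_pair_indep_set:
  assumes "indep_set \<X> \<Y>" and [measurable]: "X \<in> M \<rightarrow>\<^sub>M S" "Y \<in> M \<rightarrow>\<^sub>M N"
    and "\<And>A. A \<in> sets S \<Longrightarrow> X -` A \<inter> space M \<in> \<X>"
    and "\<And>B. B \<in> sets N \<Longrightarrow> Y -` B \<inter> space M \<in> \<Y>"
    and [measurable]: "f \<in> borel_measurable (S \<Otimes>\<^sub>M N)"
  shows "(\<integral>\<^sup>+ \<omega>. f (X \<omega>, Y \<omega>) \<partial>M) = (\<integral>\<^sup>+ \<omega>. \<integral>\<^sup>+ \<omega>'. f (X \<omega>', Y \<omega>) \<partial>M \<partial>M)"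
proof -
  interpret X: prob_space "distr M S X" by (rule prob_space_distr) measurable
  interpret Y: prob_space "distr M N Y" by (rule prob_space_distr) measurable
  interpret pair_sigma_finite "distr M S X" "distr M N Y" ..
  have "(\<integral>\<^sup>+ \<omega>. f (X \<omega>, Y \<omega>) \<partial>M) = (\<integral>\<^sup>+ z. f z \<partial>(distr M S X \<Otimes>\<^sub>M distr M N Y))"
    by (simp add: nn_integral_distr flip: distr_pair_indep_set[OF assms(1-5)])
  also have "\<dots> = (\<integral>\<^sup>+ y. \<integral>\<^sup>+ x. f (x, y) \<partial>distr M S X \<partial>distr M N Y)"
    by (rule nn_integral_snd[symmetric]) simp
  also have "\<dots> = (\<integral>\<^sup>+ \<omega>. \<integral>\<^sup>+ x. f (x, Y \<omega>) \<partial>distr M S X \<partial>M)"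
    by (subst nn_integral_distr) simp_all
  also have "\<dots> = (\<integral>\<^sup>+ \<omega>. \<integral>\<^sup>+ \<omega>'. f (X \<omega>', Y \<omega>) \<partial>M \<partial>M)"
    by (intro nn_integral_cong) (subst nn_integral_distr, simp_all)
  finally show ?thesis .
qed

lemma proc_sigma_measurable:
  obtains N where "space N = space M" "sets N = proc_sigma M Y" "\<And>t. 0 \<le> t \<Longrightarrow> Y t \<in> borel_measurable N"
proof
  let ?G = "{Y t -` A \<inter> space M | t A. 0 \<le> t \<and> A \<in> sets borel}"
  let ?N = "sigma (space M) ?G"
  have generators: "?G \<subseteq> Pow (space M)" by auto
  show space: "space ?N = space M" by (rule space_measure_of[OF generators])
  show sets: "sets ?N = proc_sigma M Y" unfolding proc_sigma_def by (rule sets_measure_of[OF generators])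
  show "Y t \<in> borel_measurable ?N" if "0 \<le> t" for t
  proof (rule measurableI)
    fix A :: "'b set" assume "A \<in> sets borel"
    with that show "Y t -` A \<inter> space ?N \<in> sets ?N"
      unfolding space sets proc_sigma_def by (intro sigma_sets.Basic) blast
  qed simp
qed

lemma
  fixes W :: "real \<Rightarrow> 'a \<Rightarrow> real ^ 'd::finite"
  assumes W: "wiener_process M W" and T: "subordinator M T"
    and ind: "prob_space.indep_set M (proc_sigma M W) (proc_sigma M T)"
    and "0 < t"
  shows wiener_subordinated_measurable: "(\<lambda>\<omega>. W (T t \<omega>) \<omega>) \<in> borel_measurable M"
    and nn_integral_wiener_subordinated: "f \<in> borel_measurable borel \<Longrightarrow>
      (\<integral>\<^sup>+ \<omega>. f (W (T t \<omega>) \<omega>) \<partial>M) = (\<integral>\<^sup>+ \<omega>. \<integral>\<^sup>+ w. f w \<partial>gauss_vec (T t \<omega>) \<partial>M)"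
proof -
  interpret prob_space M using W by (simp add: wiener_process_def)
  obtain N where N: "space N = space M" "sets N = proc_sigma M W"
    and W_measurable: "\<And>t. 0 \<le> t \<Longrightarrow> W t \<in> borel_measurable N"
    using proc_sigma_measurable[of M W] by blast
  have "sets N \<subseteq> sets M"
    using ind by (simp add: indep_sets2_eq N)
  moreover have vimage_id: "(\<lambda>\<omega>. \<omega>) -` A \<inter> space M = A" if "A \<in> sets N" for A
    using sets.sets_into_space[OF that] by (auto simp: N(1))
  ultimately have id: "(\<lambda>\<omega>. \<omega>) \<in> M \<rightarrow>\<^sub>M N"
    by (intro measurableI) (auto simp: N(1))
  have T_measurable: "T t \<in> M \<rightarrow>\<^sub>M borel_pos" by (rule subordinator_measurable_pos[OF T \<open>0 < t\<close>])
  have "(\<lambda>(r, \<omega>). W r \<omega>) \<in> borel_measurable (borel_pos \<Otimes>\<^sub>M N)"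
    using W by (intro continuous_process_measurable_pair W_measurable) (auto simp: wiener_process_def N)
  from measurable_compose[OF measurable_pair_swap' this]
  have W_pair: "(\<lambda>p. W (snd p) (fst p)) \<in> borel_measurable (N \<Otimes>\<^sub>M borel_pos)"
    by (simp add: split_beta')
  from measurable_compose[OF measurable_Pair[OF id T_measurable] this]
  show "(\<lambda>\<omega>. W (T t \<omega>) \<omega>) \<in> borel_measurable M" by simp
  assume f [measurable]: "f \<in> borel_measurable borel"
  have id_proc: "(\<lambda>\<omega>. \<omega>) -` A \<inter> space M \<in> proc_sigma M W" if "A \<in> sets N" for A
    using that by (simp only: vimage_id N(2)[symmetric])
  have T_proc: "T t -` A \<inter> space M \<in> proc_sigma M T" if "A \<in> sets borel_pos" for A
    unfolding proc_sigma_def using that \<open>0 < t\<close>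
    by (intro sigma_sets.Basic CollectI exI[of _ t] exI[of _ A]) (simp add: sets_restrict_space_iff)
  have "(\<integral>\<^sup>+ \<omega>. f (W (T t \<omega>) \<omega>) \<partial>M) = (\<integral>\<^sup>+ \<omega>. \<integral>\<^sup>+ \<omega>'. f (W (T t \<omega>) \<omega>') \<partial>M \<partial>M)"
    using nn_integral_pair_indep_set[OF ind id T_measurable id_proc T_proc measurable_compose[OF W_pair f]]
    by simp
  also have "\<dots> = (\<integral>\<^sup>+ \<omega>. \<integral>\<^sup>+ w. f w \<partial>gauss_vec (T t \<omega>) \<partial>M)"
  proof (rule nn_integral_cong)
    fix \<omega> assume "\<omega> \<in> space M"
    then have "0 < T t \<omega>" by (rule subordinator_pos[OF T \<open>0 < t\<close>])
    moreover have "W (T t \<omega>) \<in> borel_measurable M" using W by (simp add: wiener_process_def)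
    ultimately show "(\<integral>\<^sup>+ \<omega>'. f (W (T t \<omega>) \<omega>') \<partial>M) = (\<integral>\<^sup>+ w. f w \<partial>gauss_vec (T t \<omega>))"
      by (simp add: nn_integral_distr flip: wiener_process_distr[OF W])
  qed
  finally show "(\<integral>\<^sup>+ \<omega>. f (W (T t \<omega>) \<omega>) \<partial>M) = (\<integral>\<^sup>+ \<omega>. \<integral>\<^sup>+ w. f w \<partial>gauss_vec (T t \<omega>) \<partial>M)" .
qed

definition subord_law :: "'b measure \<Rightarrow> (real \<Rightarrow> 'b \<Rightarrow> real) \<Rightarrow> real \<Rightarrow> (real ^ 'd::finite) measure" where
  "subord_law M T t = M \<bind> (\<lambda>\<omega>. gauss_vec (T t \<omega>))"

context
  fixes M :: "'b measure" and T :: "real \<Rightarrow> 'b \<Rightarrow> real" and t :: real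
  assumes T: "subordinator M T" and t: "0 < t"
begin

interpretation prob_space M using T by (simp add: subordinator_def)

lemma gauss_vec_subordinator_measurable:
  "(\<lambda>\<omega>. gauss_vec (T t \<omega>)) \<in> M \<rightarrow>\<^sub>M (prob_algebra borel :: (real ^ 'd::finite) measure measure)"
  by (rule measurable_compose[OF subordinator_measurable_pos[OF T t] gauss_vec_measurable])

lemma gauss_vec_subordinator_subprob:
  "(\<lambda>\<omega>. gauss_vec (T t \<omega>)) \<in> M \<rightarrow>\<^sub>M (subprob_algebra borel :: (real ^ 'd::finite) measure measure)"
  by (rule measurable_prob_algebraD[OF gauss_vec_subordinator_measurable])

lemma sets_subord_law: "sets (subord_law M T t :: (real ^ 'd::finite) measure) = sets borel"
  by (simp add: subord_law_def not_empty)

lemma prob_space_subord_law: "prob_space (subord_law M T t :: (real ^ 'd::finite) measure)"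
  unfolding subord_law_def
  by (rule prob_space_bind'[OF _ gauss_vec_subordinator_measurable])
    (simp add: space_prob_algebra prob_space_axioms)

lemma nn_integral_subord_law:
  fixes f :: "real ^ 'd::finite \<Rightarrow> ennreal"
  assumes "f \<in> borel_measurable borel"
  shows "(\<integral>\<^sup>+ w. f w \<partial>subord_law M T t) = (\<integral>\<^sup>+ \<omega>. \<integral>\<^sup>+ w. f w \<partial>gauss_vec (T t \<omega>) \<partial>M)"
  unfolding subord_law_def by (rule nn_integral_bind[OF assms gauss_vec_subordinator_subprob])

lemma integrable_integral_gauss_vec_subordinator:
  fixes f :: "real ^ 'd::finite \<Rightarrow> real"
  assumes f: "bounded_borel m f"
  shows "integrable M (\<lambda>\<omega>. \<integral> w. f w \<partial>gauss_vec (T t \<omega>))"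
proof (rule integrable_const_bound[of _ m])
  show "(\<lambda>\<omega>. \<integral> w. f w \<partial>gauss_vec (T t \<omega>)) \<in> borel_measurable M"
    using bounded_borel_measurable[OF f]
    by (intro measurable_compose[OF gauss_vec_subordinator_subprob integral_measurable_subprob_algebra])
  show "AE \<omega> in M. norm (\<integral> w. f w \<partial>gauss_vec (T t \<omega>)) \<le> m"
  proof (rule AE_I2)
    fix \<omega> assume "\<omega> \<in> space M"
    note prob_space_gauss_vec[OF subordinator_pos[OF T t this]]
    from prob_space.abs_integral_bounded_borel_le[OF this f, of "\<lambda>w. w"]
    show "norm (\<integral> w. f w \<partial>gauss_vec (T t \<omega>)) \<le> m" by simp
  qed
qed

lemma integral_subord_law:
  fixes f :: "real ^ 'd::finite \<Rightarrow> real"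
  assumes f: "bounded_borel m f"
  shows "(\<integral> w. f w \<partial>subord_law M T t) = (\<integral> \<omega>. \<integral> w. f w \<partial>gauss_vec (T t \<omega>) \<partial>M)"
proof -
  have "AE \<omega> in M. emeasure (gauss_vec (T t \<omega>) :: (real ^ 'd) measure) (space (gauss_vec (T t \<omega>))) \<le> ennreal 1"
    using gauss_vec_subordinator_subprob
    by (intro AE_I2)
      (auto dest!: measurable_space subprob_space.emeasure_space_le_1 simp: space_subprob_algebra)
  from integral_bind[OF bounded_borel_measurable[OF f] bounded_borel_le[OF f]
      gauss_vec_subordinator_subprob finite_measure_axioms this]
  show ?thesis by (simp add: subord_law_def)
qed

end

lemma distr_wiener_subordinated:
  fixes W :: "real \<Rightarrow> 'a \<Rightarrow> real ^ 'd::finite"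
  assumes W: "wiener_process M W" and T: "subordinator M T"
    and ind: "prob_space.indep_set M (proc_sigma M W) (proc_sigma M T)"
    and t: "0 < t"
  shows "distr M borel (\<lambda>\<omega>. W (T t \<omega>) \<omega>) = subord_law M T t"
proof (rule measure_eqI_nn_integral)
  note [measurable] = wiener_subordinated_measurable[OF assms]
  fix f :: "real ^ 'd \<Rightarrow> ennreal" assume "f \<in> borel_measurable (subord_law M T t)"
  then have [measurable]: "f \<in> borel_measurable borel"
    by (simp add: measurable_cong_sets[OF sets_subord_law[OF T t] refl])
  show "(\<integral>\<^sup>+ w. f w \<partial>distr M borel (\<lambda>\<omega>. W (T t \<omega>) \<omega>)) = (\<integral>\<^sup>+ w. f w \<partial>subord_law M T t)"
    by (simp add: nn_integral_distr nn_integral_wiener_subordinated[OF assms] nn_integral_subord_law[OF T t])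
qed (simp add: sets_subord_law[OF T t])

lemma same_fdd_distr:
  assumes fdd: "same_fdd M T N S" and "0 \<le> t"
    and [measurable]: "T t \<in> borel_measurable M" "S t \<in> borel_measurable N"
  shows "distr M borel (T t) = distr N borel (S t)"
proof -
  let ?P = "PiM {..<1::nat} (\<lambda>_. borel :: real measure)"
  have eq_at_t: "distr M ?P (\<lambda>\<omega>. \<lambda>i\<in>{..<1}. T t \<omega>) = distr N ?P (\<lambda>\<omega>. \<lambda>i\<in>{..<1}. S t \<omega>)"
    using fdd[unfolded same_fdd_def, rule_format, of 1 "\<lambda>_. t"] \<open>0 \<le> t\<close> by simp
  have "distr M borel (T t) = distr (distr M ?P (\<lambda>\<omega>. \<lambda>i\<in>{..<1}. T t \<omega>)) borel (\<lambda>g. g 0)"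
    by (subst distr_distr) (auto simp: comp_def)
  also have "\<dots> = distr N borel (S t)"
    unfolding eq_at_t by (subst distr_distr) (auto simp: comp_def)
  finally show ?thesis .
qed

lemma subord_law_cong:
  assumes T: "subordinator M T" and S: "subordinator N S"
    and distr: "distr M borel (T t) = distr N borel (S t)" and "0 < t"
  shows "subord_law M T t = (subord_law N S t :: (real ^ 'd::finite) measure)"
proof (rule measure_eqI_nn_integral)
  have [measurable]: "T t \<in> borel_measurable M" "S t \<in> borel_measurable N"
    using T S by (auto simp: subordinator_def)
  fix f :: "real ^ 'd \<Rightarrow> ennreal" assume "f \<in> borel_measurable (subord_law N S t)"
  then have [measurable]: "f \<in> borel_measurable borel"
    by (simp add: measurable_cong_sets[OF sets_subord_law[OF S \<open>0 < t\<close>] refl])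
  have "(\<integral>\<^sup>+ w. f w \<partial>subord_law M T t) = (\<integral>\<^sup>+ r. \<integral>\<^sup>+ w. f w \<partial>gauss_vec r \<partial>distr M borel (T t))"
    by (simp add: nn_integral_subord_law[OF T \<open>0 < t\<close>] nn_integral_distr)
  also have "\<dots> = (\<integral>\<^sup>+ w. f w \<partial>subord_law N S t)"
    by (simp add: nn_integral_subord_law[OF S \<open>0 < t\<close>] nn_integral_distr distr)
  finally show "(\<integral>\<^sup>+ w. f w \<partial>subord_law M T t) = (\<integral>\<^sup>+ w. f w \<partial>subord_law N S t)" .
qed (simp add: sets_subord_law[OF T \<open>0 < t\<close>] sets_subord_law[OF S \<open>0 < t\<close>])

lemma indep_increments_distr_add:
  fixes Y :: "real \<Rightarrow> 'a \<Rightarrow> 'b::ordered_euclidean_space"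
  assumes "prob_space M" and ind: "indep_increments M Y" and Y0: "\<And>\<omega>. \<omega> \<in> space M \<Longrightarrow> Y 0 \<omega> = 0"
    and [measurable]: "\<And>t. Y t \<in> borel_measurable M" and "0 < s" "0 < t"
  shows "distr M borel (Y (s + t)) = (distr M borel (Y s) \<star> distr M borel (\<lambda>\<omega>. Y (s + t) \<omega> - Y s \<omega>))"
proof -
  interpret prob_space M by fact
  define ts where "ts = (\<lambda>i::nat. if i = 0 then 0 else if i = 1 then s else s + t)"
  have "0 \<le> ts 0 \<and> (\<forall>i<2. ts i < ts (Suc i))"
    using \<open>0 < s\<close> \<open>0 < t\<close> by (auto simp: ts_def less_2_cases_iff)
  with ind have "indep_vars (\<lambda>_. borel) (\<lambda>i \<omega>. Y (ts (Suc i)) \<omega> - Y (ts i) \<omega>) {..<2::nat}"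
    unfolding indep_increments_def by blast
  from indep_var_restrict[OF this, of "{0}" "{1}"]
  have "indep_var (PiM {0} (\<lambda>_. borel)) (\<lambda>\<omega>. \<lambda>i\<in>{0}. Y (ts (Suc i)) \<omega> - Y (ts i) \<omega>)
      (PiM {1} (\<lambda>_. borel)) (\<lambda>\<omega>. \<lambda>i\<in>{1}. Y (ts (Suc i)) \<omega> - Y (ts i) \<omega>)"
    by auto
  from indep_var_compose[OF this, of "\<lambda>g. g 0" borel "\<lambda>g. g 1" borel]
  have "indep_var borel (\<lambda>\<omega>. Y s \<omega> - Y 0 \<omega>) borel (\<lambda>\<omega>. Y (s + t) \<omega> - Y s \<omega>)"
    by (simp add: comp_def ts_def)
  from sum_indep_random_variable[OF this]
  have "distr M borel (\<lambda>\<omega>. Y (s + t) \<omega> - Y 0 \<omega>)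
      = (distr M borel (\<lambda>\<omega>. Y s \<omega> - Y 0 \<omega>) \<star> distr M borel (\<lambda>\<omega>. Y (s + t) \<omega> - Y s \<omega>))"
    by simp
  moreover have "distr M borel (\<lambda>\<omega>. Y u \<omega> - Y 0 \<omega>) = distr M borel (Y u)" for u
    by (intro distr_cong) (auto simp: Y0)
  ultimately show ?thesis by simp
qed

lemma nn_integral_convolution_subord_law:
  fixes f :: "real ^ 'd::finite \<Rightarrow> ennreal"
  assumes T: "subordinator M T" and t: "0 < t"
    and "finite_measure \<mu>" and sets_\<mu> [measurable_cong]: "sets \<mu> = sets borel"
    and f [measurable]: "f \<in> borel_measurable borel"
  shows "(\<integral>\<^sup>+ w. f w \<partial>(\<mu> \<star> subord_law M T t)) = (\<integral>\<^sup>+ \<omega>. \<integral>\<^sup>+ w. f w \<partial>(\<mu> \<star> gauss_vec (T t \<omega>)) \<partial>M)"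
proof -
  interpret prob_space M using T by (simp add: subordinator_def)
  interpret \<mu>: finite_measure \<mu> by fact
  interpret \<nu>: prob_space "subord_law M T t :: (real ^ 'd) measure" by (rule prob_space_subord_law[OF T t])
  interpret pair_sigma_finite M \<mu> ..
  have "(\<lambda>p. \<integral>\<^sup>+ z. f (snd p + z) \<partial>gauss_vec (T t (fst p))) \<in> borel_measurable (M \<Otimes>\<^sub>M \<mu>)"
    by (rule nn_integral_measurable_subprob_algebra2)
      (measurable, rule measurable_compose[OF measurable_fst gauss_vec_subordinator_subprob[OF T t]])
  then have inner_measurable: "(\<lambda>(\<omega>, y). \<integral>\<^sup>+ z. f (y + z) \<partial>gauss_vec (T t \<omega>)) \<in> borel_measurable (M \<Otimes>\<^sub>M \<mu>)"
    by (simp add: split_beta')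
  have "(\<integral>\<^sup>+ w. f w \<partial>(\<mu> \<star> subord_law M T t)) = (\<integral>\<^sup>+ y. \<integral>\<^sup>+ z. f (y + z) \<partial>subord_law M T t \<partial>\<mu>)"
    by (rule nn_integral_convolution)
      (simp_all add: \<mu>.finite_measure_axioms \<nu>.finite_measure_axioms sets_subord_law[OF T t] sets_\<mu> f)
  also have "\<dots> = (\<integral>\<^sup>+ y. \<integral>\<^sup>+ \<omega>. \<integral>\<^sup>+ z. f (y + z) \<partial>gauss_vec (T t \<omega>) \<partial>M \<partial>\<mu>)"
    by (intro nn_integral_cong nn_integral_subord_law[OF T t]) measurable
  also have "\<dots> = (\<integral>\<^sup>+ \<omega>. \<integral>\<^sup>+ y. \<integral>\<^sup>+ z. f (y + z) \<partial>gauss_vec (T t \<omega>) \<partial>\<mu> \<partial>M)"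
    by (rule Fubini'[OF inner_measurable])
  also have "\<dots> = (\<integral>\<^sup>+ \<omega>. \<integral>\<^sup>+ w. f w \<partial>(\<mu> \<star> gauss_vec (T t \<omega>)) \<partial>M)"
  proof (rule nn_integral_cong)
    fix \<omega> assume "\<omega> \<in> space M"
    from prob_space_gauss_vec[OF subordinator_pos[OF T t this]]
    show "(\<integral>\<^sup>+ y. \<integral>\<^sup>+ z. f (y + z) \<partial>gauss_vec (T t \<omega>) \<partial>\<mu>) = (\<integral>\<^sup>+ w. f w \<partial>(\<mu> \<star> gauss_vec (T t \<omega>)))"
      by (intro nn_integral_convolution[symmetric])
        (auto simp: sets_\<mu> \<mu>.finite_measure_axioms intro: prob_space.finite_measure)
  qed
  finally show ?thesis .
qed

lemma subord_law_add:
  assumes T: "subordinator M T" and pos: "0 < s" "0 < t"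
  shows "subord_law M T (s + t) = (subord_law M T s \<star> subord_law M T t :: (real ^ 'd::finite) measure)"
proof (rule measure_eqI_nn_integral)
  let ?\<nu> = "\<lambda>t. subord_law M T t :: (real ^ 'd) measure"
  let ?\<gamma> = "\<lambda>r. gauss_vec r :: (real ^ 'd) measure"
  have "0 < s + t" using pos by simp
  interpret prob_space M using T by (simp add: subordinator_def)
  interpret \<nu>s: prob_space "?\<nu> s" by (rule prob_space_subord_law[OF T pos(1)])
  interpret \<nu>t: prob_space "?\<nu> t" by (rule prob_space_subord_law[OF T pos(2)])
  have [measurable]: "T u \<in> borel_measurable M" for u using T by (simp add: subordinator_def)
  have \<gamma>_finite: "finite_measure (?\<gamma> (T u \<omega>))" if "\<omega> \<in> space M" "0 < u" for \<omega> u
    by (rule prob_space.finite_measure[OF prob_space_gauss_vec[OF subordinator_pos[OF T that(2,1)]]])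
  note finite = \<gamma>_finite \<nu>s.finite_measure_axioms \<nu>t.finite_measure_axioms
  fix f :: "real ^ 'd \<Rightarrow> ennreal" assume "f \<in> borel_measurable (?\<nu> s \<star> ?\<nu> t)"
  then have [measurable]: "f \<in> borel_measurable borel" by simp
  have distr_add: "distr M borel (T (s + t)) = (distr M borel (T s) \<star> distr M borel (T t))"
    using T pos indep_increments_distr_add[of M T s t] by (simp add: subordinator_def)
  have "(\<integral>\<^sup>+ w. f w \<partial>?\<nu> (s + t)) = (\<integral>\<^sup>+ r. \<integral>\<^sup>+ w. f w \<partial>?\<gamma> r \<partial>distr M borel (T (s + t)))"
    by (simp add: nn_integral_subord_law[OF T \<open>0 < s + t\<close>] nn_integral_distr)
  also have "\<dots> = (\<integral>\<^sup>+ \<omega>. \<integral>\<^sup>+ \<omega>'. \<integral>\<^sup>+ w. f w \<partial>?\<gamma> (T s \<omega> + T t \<omega>') \<partial>M \<partial>M)"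
    unfolding distr_add by (simp add: nn_integral_convolution nn_integral_distr finite_measure_distr)
  also have "\<dots> = (\<integral>\<^sup>+ \<omega>. \<integral>\<^sup>+ \<omega>'. \<integral>\<^sup>+ w. f w \<partial>(?\<gamma> (T s \<omega>) \<star> ?\<gamma> (T t \<omega>')) \<partial>M \<partial>M)"
    using subordinator_pos[OF T] pos by (intro nn_integral_cong) (simp add: gauss_vec_add)
  also have "\<dots> = (\<integral>\<^sup>+ \<omega>. \<integral>\<^sup>+ w. f w \<partial>(?\<nu> t \<star> ?\<gamma> (T s \<omega>)) \<partial>M)"
    using pos by (intro nn_integral_cong)
      (simp add: nn_integral_convolution_subord_law[OF T] convolution_commutative[of "?\<nu> t"] finite
        sets_subord_law[OF T])
  also have "\<dots> = (\<integral>\<^sup>+ w. f w \<partial>(?\<nu> s \<star> ?\<nu> t))"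
    using pos by (simp add: nn_integral_convolution_subord_law[OF T] convolution_commutative[of "?\<nu> s"] finite
        sets_subord_law[OF T])
  finally show "(\<integral>\<^sup>+ w. f w \<partial>?\<nu> (s + t)) = (\<integral>\<^sup>+ w. f w \<partial>(?\<nu> s \<star> ?\<nu> t))" .
qed (use pos in \<open>simp add: sets_subord_law[OF T]\<close>)

section \<open>Total variation\<close>

lemma lipschitz_on_borel_measurable:
  fixes f :: "'a::metric_space \<Rightarrow> 'b::metric_space"
  shows "L-lipschitz_on UNIV f \<Longrightarrow> f \<in> borel_measurable borel"
  by (intro borel_measurable_continuous_onI lipschitz_on_continuous_on)

lemma lipschitz_on_infdist: "1-lipschitz_on UNIV (\<lambda>x. infdist x C)"
  using infdist_triangle_abs by (intro lipschitz_onI) (auto simp: dist_real_def)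

lemma lipschitz_on_max_const:
  fixes f :: "'a::metric_space \<Rightarrow> real"
  assumes "L-lipschitz_on S f"
  shows "L-lipschitz_on S (\<lambda>x. max a (f x))"
proof (rule lipschitz_onI)
  fix x y assume "x \<in> S" "y \<in> S"
  have "dist (max a (f x)) (max a (f y)) \<le> dist (f x) (f y)"
    by (auto simp: dist_real_def)
  also have "\<dots> \<le> L * dist x y"
    by (rule lipschitz_onD[OF assms]) fact+
  finally show "dist (max a (f x)) (max a (f y)) \<le> L * dist x y" .
qed (rule lipschitz_on_nonneg[OF assms])

lemma infdist_cutoff_tendsto_indicator:
  assumes "closed C" "C \<noteq> {}"
  shows "(\<lambda>n. max 0 (1 - real n * infdist x C)) \<longlonglongrightarrow> indicator C x"
proof (cases "x \<in> C")
  case False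
  then have "0 < infdist x C" using infdist_pos_not_in_closed assms by blast
  then obtain k where "1 < real k * infdist x C" using reals_Archimedean3 by blast
  then have "max 0 (1 - real n * infdist x C) = 0" if "k \<le> n" for n
    using mult_right_mono[OF of_nat_mono[OF that] infdist_nonneg, of x C] by simp
  then show ?thesis
    using False by (intro tendsto_eventually eventually_sequentiallyI[of k]) simp
qed simp

lemma sum_indicator_levels:
  assumes "0 \<le> y" "y \<le> real n"
  shows "(\<Sum>k=1..n. indicator {real k..} y) = real_of_int \<lfloor>y\<rfloor>"
proof -
  have "{1..n} \<inter> {k. real k \<le> y} = {1..nat \<lfloor>y\<rfloor>}"
    using assms by (auto simp: le_nat_iff le_floor_iff)
  then show ?thesis
    using assms by (simp add: indicator_def sum.If_cases of_nat_nat)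
qed

lemma (in prob_space)
  assumes [measurable]: "X \<in> borel_measurable M" and X: "\<And>\<omega>. 0 \<le> X \<omega>" "\<And>\<omega>. X \<omega> \<le> real n"
  shows sum_prob_levels_le_expectation: "(\<Sum>k=1..n. prob {\<omega> \<in> space M. real k \<le> X \<omega>}) \<le> expectation X"
    and expectation_le_sum_prob_levels: "expectation X \<le> (\<Sum>k=1..n. prob {\<omega> \<in> space M. real k \<le> X \<omega>}) + 1"
proof -
  let ?level = "\<lambda>k. {\<omega> \<in> space M. real k \<le> X \<omega>}"
  let ?S = "\<lambda>\<omega>. \<Sum>k=1..n. indicat_real (?level k) \<omega>"
  have "integrable M (indicat_real (?level k))" for k
    by (intro integrable_const_bound[of _ 1]) auto
  then have S_integral: "integrable M ?S" "expectation ?S = (\<Sum>k=1..n. prob (?level k))"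
    by simp_all
  have "integrable M X"
    using X by (intro integrable_const_bound[of _ "real n"]) auto
  have "?S \<omega> = real_of_int \<lfloor>X \<omega>\<rfloor>" if "\<omega> \<in> space M" for \<omega>
    using sum_indicator_levels[OF X] that by (simp add: indicator_def)
  then have S_bounds: "?S \<omega> \<le> X \<omega>" "X \<omega> \<le> ?S \<omega> + 1" if "\<omega> \<in> space M" for \<omega>
    using that by simp_all
  show "(\<Sum>k=1..n. prob (?level k)) \<le> expectation X"
    using integral_mono[OF S_integral(1) \<open>integrable M X\<close> S_bounds(1)] S_integral(2) by simp
  have "expectation X \<le> expectation (\<lambda>\<omega>. ?S \<omega> + 1)"
    using S_bounds(2) S_integral(1) by (intro integral_mono \<open>integrable M X\<close>) auto
  then show "expectation X \<le> (\<Sum>k=1..n. prob (?level k)) + 1"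
    using S_integral by (simp add: prob_space)
qed

context
  fixes \<mu> \<nu> :: "'a::polish_space measure" and K :: real
  assumes prob: "prob_space \<mu>" "prob_space \<nu>" and sets: "sets \<mu> = sets borel" "sets \<nu> = sets borel"
    and lipschitz_test: "\<And>f L. L-lipschitz_on UNIV f \<Longrightarrow> (\<And>x. \<bar>f x\<bar> \<le> 1) \<Longrightarrow>
      (\<integral> x. f x \<partial>\<mu>) \<le> (\<integral> x. f x \<partial>\<nu>) + K"
begin

interpretation \<mu>: prob_space \<mu> by (rule prob)

interpretation \<nu>: prob_space \<nu> by (rule prob)

declare sets [measurable_cong]

lemma lipschitz_test_imp_nonneg: "0 \<le> K"
  using lipschitz_test[OF lipschitz_on_constant, of 0] by simp

lemma lipschitz_test_imp_measure_closed_le: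
  assumes "closed C"
  shows "measure \<mu> C \<le> measure \<nu> C + K"
proof (cases "C = {}")
  case False
  define f where "f n x = max 0 (1 - real n * infdist x C)" for n x
  have lip: "(real n)-lipschitz_on UNIV (f n)" for n
  proof -
    have "(0 + \<bar>real n\<bar> * 1)-lipschitz_on UNIV (\<lambda>x. 1 - real n * infdist x C)"
      by (intro lipschitz_intros lipschitz_on_infdist)
    then show ?thesis
      unfolding f_def by (intro lipschitz_on_max_const) simp
  qed
  have f_abs_le: "\<bar>f n x\<bar> \<le> 1" for n x
    by (simp add: f_def infdist_nonneg)
  have [measurable]: "C \<in> sets borel" "f n \<in> borel_measurable borel" for n
    using assms lipschitz_on_borel_measurable[OF lip] by auto
  have "(\<lambda>n. f n x) \<longlonglongrightarrow> indicator C x" for x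
    unfolding f_def by (rule infdist_cutoff_tendsto_indicator[OF assms False])
  then have "(\<lambda>n. \<integral> x. f n x \<partial>\<nu>) \<longlonglongrightarrow> (\<integral> x. indicator C x \<partial>\<nu>)"
    by (intro integral_dominated_convergence[where w = "\<lambda>_. 1"]) (auto simp: f_abs_le)
  then have "(\<lambda>n. (\<integral> x. f n x \<partial>\<nu>) + K) \<longlonglongrightarrow> measure \<nu> C + K"
    by (intro tendsto_add tendsto_const) simp
  moreover have "measure \<mu> C \<le> (\<integral> x. f n x \<partial>\<nu>) + K" for n
  proof -
    have "indicator C x \<le> f n x" for x
      by (simp add: f_def split: split_indicator)
    moreover have "integrable \<mu> (f n)" "integrable \<mu> (indicat_real C)"
      by (auto intro!: \<mu>.integrable_const_bound[of _ 1] simp: f_abs_le)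
    ultimately have "(\<integral> x. indicator C x \<partial>\<mu>) \<le> (\<integral> x. f n x \<partial>\<mu>)"
      by (intro integral_mono)
    also have "\<dots> \<le> (\<integral> x. f n x \<partial>\<nu>) + K"
      by (rule lipschitz_test[OF lip f_abs_le])
    finally show ?thesis by simp
  qed
  ultimately show ?thesis by (auto intro: LIMSEQ_le_const)
qed (simp add: lipschitz_test_imp_nonneg)

lemma lipschitz_test_imp_measure_le:
  assumes [measurable]: "A \<in> sets borel"
  shows "measure \<mu> A \<le> measure \<nu> A + K"
proof -
  have "emeasure \<mu> A = (SUP C \<in> {C. C \<subseteq> A \<and> compact C}. emeasure \<mu> C)"
    by (rule inner_regular[OF sets(1)]) simp_all
  also have "\<dots> \<le> ennreal (measure \<nu> A + K)"
  proof (rule SUP_least)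
    fix C assume "C \<in> {C. C \<subseteq> A \<and> compact C}"
    then have "measure \<mu> C \<le> measure \<nu> C + K" "measure \<nu> C \<le> measure \<nu> A"
      by (auto intro: lipschitz_test_imp_measure_closed_le compact_imp_closed \<nu>.finite_measure_mono)
    then show "emeasure \<mu> C \<le> ennreal (measure \<nu> A + K)"
      by (simp add: \<mu>.emeasure_eq_measure ennreal_leI)
  qed
  finally show ?thesis
    using lipschitz_test_imp_nonneg by (simp add: \<mu>.emeasure_eq_measure del: ennreal_plus)
qed

text \<open>A function is approximated by the averages of the indicators of its upper level sets.\<close>

lemma lipschitz_test_imp_integral_unit_le:
  assumes [measurable]: "g \<in> borel_measurable borel" and g_unit: "\<And>x. 0 \<le> g x" "\<And>x. g x \<le> 1"
  shows "(\<integral> x. g x \<partial>\<mu>) \<le> (\<integral> x. g x \<partial>\<nu>) + K"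
proof (rule LIMSEQ_le_const)
  show "(\<lambda>n. (\<integral> x. g x \<partial>\<nu>) + K + inverse (real (Suc n))) \<longlonglongrightarrow> (\<integral> x. g x \<partial>\<nu>) + K"
    using tendsto_add[OF tendsto_const LIMSEQ_inverse_real_of_nat] by simp
  have "(\<integral> x. g x \<partial>\<mu>) \<le> (\<integral> x. g x \<partial>\<nu>) + K + inverse (real n)" if "0 < n" for n
  proof -
    let ?level = "\<lambda>k. {x. real k \<le> real n * g x}"
    have scaled_unit: "0 \<le> real n * g x" "real n * g x \<le> real n" for x
      using g_unit by (simp_all add: mult_left_le)
    have space: "space \<mu> = UNIV" "space \<nu> = UNIV"
      using sets[THEN sets_eq_imp_space_eq] by simp_all
    have "real n * (\<integral> x. g x \<partial>\<mu>) \<le> (\<Sum>k=1..n. measure \<mu> (?level k)) + 1"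
      using \<mu>.expectation_le_sum_prob_levels[OF _ scaled_unit] by (simp add: space)
    also have "\<dots> \<le> (\<Sum>k=1..n. measure \<nu> (?level k) + K) + 1"
      by (intro add_right_mono sum_mono lipschitz_test_imp_measure_le) simp
    also have "\<dots> \<le> real n * (\<integral> x. g x \<partial>\<nu>) + real n * K + 1"
      using \<nu>.sum_prob_levels_le_expectation[OF _ scaled_unit] by (simp add: space sum.distrib)
    finally show ?thesis
      using \<open>0 < n\<close> by (simp add: field_simps)
  qed
  then show "\<exists>N. \<forall>n\<ge>N. (\<integral> x. g x \<partial>\<mu>) \<le> (\<integral> x. g x \<partial>\<nu>) + K + inverse (real (Suc n))"
    by blast
qed

lemma lipschitz_test_imp_integral_le:
  assumes f: "bounded_borel m f"
  shows "(\<integral> x. f x \<partial>\<mu>) \<le> (\<integral> x. f x \<partial>\<nu>) + 2 * m * K"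
proof (cases "m = 0")
  case True
  then show ?thesis using bounded_borel_le[OF f] by simp
next
  case False
  with bounded_borel_nonneg[OF f] have "0 < m" by simp
  define g where "g x = (f x + m) / (2 * m)" for x
  have f_eq: "f x = 2 * m * g x - m" for x using \<open>0 < m\<close> by (simp add: g_def)
  have [measurable]: "f \<in> borel_measurable borel" by (rule bounded_borel_measurable[OF f])
  have [measurable]: "g \<in> borel_measurable borel" unfolding g_def by measurable
  have g_unit: "0 \<le> g x" "g x \<le> 1" for x
    using bounded_borel_le[OF f, of x] \<open>0 < m\<close> by (auto simp: g_def field_simps)
  have "integrable \<mu> g" "integrable \<nu> g"
    using g_unit by (auto intro!: \<mu>.integrable_const_bound[of _ 1] \<nu>.integrable_const_bound[of _ 1])
  moreover have "2 * m * (\<integral> x. g x \<partial>\<mu>) \<le> 2 * m * ((\<integral> x. g x \<partial>\<nu>) + K)"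
    using \<open>0 < m\<close> g_unit by (intro mult_left_mono lipschitz_test_imp_integral_unit_le) auto
  ultimately show ?thesis
    unfolding f_eq by (simp add: \<mu>.prob_space \<nu>.prob_space distrib_left)
qed

lemma lipschitz_test_imp_abs_integral_diff_le:
  assumes f: "bounded_borel m f"
  shows "\<bar>(\<integral> x. f x \<partial>\<mu>) - (\<integral> x. f x \<partial>\<nu>)\<bar> \<le> 2 * m * K"
proof -
  have "bounded_borel m (\<lambda>x. - f x)" using f by (simp add: bounded_borel_def)
  from lipschitz_test_imp_integral_le[OF this] lipschitz_test_imp_integral_le[OF f]
  show ?thesis by simp
qed

end

section \<open>Limits and integrals of real functions\<close>

lemma continuous_on_uniform_approx:
  fixes f :: "'a::topological_space \<Rightarrow> 'b::metric_space"
  assumes "\<And>n. continuous_on S (g n)" and dist_le: "\<And>n x. x \<in> S \<Longrightarrow> dist (f x) (g n x) \<le> r n"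
    and r: "r \<longlonglongrightarrow> 0"
  shows "continuous_on S f"
proof -
  have "uniform_limit S g f sequentially"
  proof (rule uniform_limitI)
    fix e :: real assume "0 < e"
    with r have "\<forall>\<^sub>F n in sequentially. r n < e" by (rule order_tendstoD)
    then show "\<forall>\<^sub>F n in sequentially. \<forall>x\<in>S. dist (g n x) (f x) < e"
      by eventually_elim (metis dist_commute dist_le order_le_less_trans)
  qed
  then show ?thesis
    by (rule uniform_limit_theorem[rotated]) (simp_all add: assms)
qed

lemma set_integral_antimono_step:
  fixes f :: "real \<Rightarrow> real"
  assumes integrable_f: "set_integrable lborel {0<..\<delta>} f"
    and antimono: "\<And>s t. 0 < s \<Longrightarrow> s \<le> t \<Longrightarrow> f t \<le> f s"
    and h: "0 < h" "h \<le> s" "s \<le> \<delta>"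
  shows "(LINT u:{0<..s - h}|lborel. f u) + h * f s \<le> (LINT u:{0<..s}|lborel. f u)"
proof -
  have integrable_subset: "set_integrable lborel S f" if "S \<in> sets borel" "S \<subseteq> {0<..\<delta>}" for S
    using set_integrable_subset[OF integrable_f] that by simp
  have split: "{0<..s} = {0<..s - h} \<union> {s - h<..s}" using h by auto
  have "h * f s = (LINT u:{s - h<..s}|lborel. f s)"
    using h by (simp add: set_lebesgue_integral_def)
  also have "\<dots> \<le> (LINT u:{s - h<..s}|lborel. f u)"
    using h by (intro set_integral_mono integrable_subset antimono) (auto simp: set_integrable_def)
  finally show ?thesis
    unfolding split using h by (subst set_integral_Un) (auto intro!: integrable_subset)
qed

lemma set_integral_tendsto_0_at_right:
  fixes f :: "real \<Rightarrow> real"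
  assumes integrable_f: "set_integrable lborel {0<..\<delta>} f" and "0 < \<delta>"
  shows "((\<lambda>t. LINT u:{0<..t}|lborel. f u) \<longlongrightarrow> 0) (at_right 0)"
proof -
  have spike: "negligible {x \<in> {0<..t} - {0..t}. f x \<noteq> 0}" "negligible {x \<in> {0..t} - {0<..t}. f x \<noteq> 0}" for t
    by (rule negligible_subset[of "{0}"]; auto)+
  have "f integrable_on {0<..\<delta>}"
    by (rule set_borel_integral_eq_integral(1)[OF integrable_f])
  then have "f integrable_on {0..\<delta>}"
    by (rule integrable_spike_set[OF _ spike])
  from indefinite_integral_continuous_1[OF this, unfolded continuous_on, rule_format, of 0] \<open>0 < \<delta>\<close>
  have "((\<lambda>t. integral {0..t} f) \<longlongrightarrow> integral {0..0} f) (at 0 within {0..\<delta>})"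
    by simp
  then have "((\<lambda>t. integral {0..t} f) \<longlongrightarrow> 0) (at_right 0)"
    using \<open>0 < \<delta>\<close> by (simp add: at_within_Icc_at_right)
  moreover have "\<forall>\<^sub>F t in at_right 0. integral {0..t} f = (LINT u:{0<..t}|lborel. f u)"
  proof (rule eventually_at_rightI[OF _ \<open>0 < \<delta>\<close>])
    fix t assume "t \<in> {0<..<\<delta>}"
    then have "set_integrable lborel {0<..t} f"
      by (intro set_integrable_subset[OF integrable_f]) auto
    from set_borel_integral_eq_integral(2)[OF this]
    show "integral {0..t} f = (LINT u:{0<..t}|lborel. f u)"
      by (simp add: integral_spike_set[OF spike])
  qed
  ultimately show ?thesis
    by (rule Lim_transform_eventually)
qed

lemma SUP_ennreal_min_of_nat:
  assumes "0 \<le> a"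
  shows "(SUP n. ennreal (min a (real n))) = ennreal a"
proof -
  have "(SUP n. ennreal (min a (real n))) = (SUP n. inf (ennreal a) (of_nat n))"
    using assms by (simp add: inf_min min_ennreal ennreal_of_nat_eq_real_of_nat)
  also have "\<dots> = ennreal a"
    by (simp add: ennreal_SUP_of_nat_eq_top flip: inf_SUP)
  finally show ?thesis .
qed

section \<open>The semigroup of the noise\<close>

locale subordinated_noise =
  fixes M0 :: "'b measure" and T0 :: "real \<Rightarrow> 'b \<Rightarrow> real" and \<kappa> \<delta> :: real
  assumes T0_sub: "subordinator M0 T0" and \<kappa>: "0 \<le> \<kappa>" and delta: "0 < \<delta>"
    and integ: "(\<integral>\<^sup>+ s. indicator {0<..\<delta>} s *
          (\<integral>\<^sup>+ \<omega>. ennreal (T0 s \<omega> powr (- 1/2 - \<kappa>)) \<partial>M0) \<partial>lborel) < \<top>"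
begin

sublocale M0: prob_space M0 using T0_sub by (simp add: subordinator_def)

lemma T0_measurable [measurable]: "T0 t \<in> borel_measurable M0"
  using T0_sub by (simp add: subordinator_def)

lemma T0_mono: "\<omega> \<in> space M0 \<Longrightarrow> 0 \<le> s \<Longrightarrow> s \<le> t \<Longrightarrow> T0 s \<omega> \<le> T0 t \<omega>"
  using T0_sub by (auto simp: subordinator_def mono_on_def)

definition inverse_moment :: "real \<Rightarrow> ennreal" where
  "inverse_moment s = (\<integral>\<^sup>+ \<omega>. ennreal (T0 s \<omega> powr (- 1/2 - \<kappa>)) \<partial>M0)"

definition smoothing_rate :: "real \<Rightarrow> real" where
  "smoothing_rate s = 1 + enn2real (inverse_moment s)"

definition smoothing_integral :: "real \<Rightarrow> real" where
  "smoothing_integral t = (LINT s:{0<..t}|lborel. smoothing_rate s)"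

definition noise_sg :: "real \<Rightarrow> (real ^ 'd::finite \<Rightarrow> real) \<Rightarrow> real ^ 'd \<Rightarrow> real" where
  "noise_sg t f x = (\<integral> w. f (x + w) \<partial>subord_law M0 T0 t)"

lemma inverse_moment_antimono: "0 < s \<Longrightarrow> s \<le> t \<Longrightarrow> inverse_moment t \<le> inverse_moment s"
  unfolding inverse_moment_def using \<kappa> subordinator_pos[OF T0_sub] T0_mono
  by (intro nn_integral_mono ennreal_leI powr_mono2') (auto intro: less_imp_le)

lemma inverse_moment_finite:
  assumes "0 < s"
  shows "inverse_moment s < \<top>"
proof (rule ccontr)
  assume "\<not> inverse_moment s < \<top>"
  then have top: "inverse_moment s = \<top>" using top.not_eq_extremum by blast
  define u where "u = min s \<delta>"
  have u: "0 < u" "u \<le> s" "u \<le> \<delta>" using assms delta by (auto simp: u_def)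
  have "inverse_moment v = \<top>" if "0 < v" "v \<le> u" for v
    using inverse_moment_antimono[of v s] that u top by (simp add: top.extremum_unique)
  then have "(\<integral>\<^sup>+ v. \<top> * indicator {0<..u} v \<partial>lborel) \<le> (\<integral>\<^sup>+ v. indicator {0<..\<delta>} v * inverse_moment v \<partial>lborel)"
    using u by (intro nn_integral_mono) (auto split: split_indicator)
  moreover have "(\<integral>\<^sup>+ v. \<top> * indicator {0<..u} v \<partial>lborel) = \<top>"
    using u by (subst nn_integral_cmult) (auto simp: ennreal_top_mult)
  ultimately show False using integ by (simp add: inverse_moment_def)
qed

lemma smoothing_rate_antimono: "0 < s \<Longrightarrow> s \<le> t \<Longrightarrow> smoothing_rate t \<le> smoothing_rate s"
  unfolding smoothing_rate_def
  using inverse_moment_antimono[of s t] inverse_moment_finite[of s] by (simp add: enn2real_mono)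

lemma smoothing_rate_ge_1: "1 \<le> smoothing_rate s"
  by (simp add: smoothing_rate_def)

lemma set_integrable_smoothing_rate: "set_integrable lborel {0<..\<delta>} smoothing_rate"
proof -
  let ?m = "\<lambda>s. indicator {0<..\<delta>} s *\<^sub>R enn2real (inverse_moment s)"
  have "mono_on {0<..\<delta>} (\<lambda>s. - smoothing_rate s)"
    using smoothing_rate_antimono by (auto simp: mono_on_def)
  then have "(\<lambda>s. - (- smoothing_rate s) - 1) \<in> borel_measurable (restrict_space borel {0<..\<delta>})"
    by (intro borel_measurable_diff borel_measurable_uminus borel_measurable_mono_on_fnc borel_measurable_const)
  then have moment_measurable: "?m \<in> borel_measurable lborel"
    by (simp add: borel_measurable_restrict_space_iff smoothing_rate_def)
  have "ennreal (norm (?m s)) = indicator {0<..\<delta>} s * inverse_moment s" for s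
    using inverse_moment_finite[of s] by (auto simp: ennreal_enn2real split: split_indicator)
  then have "integrable lborel ?m"
    using integ by (intro integrableI_bounded moment_measurable) (simp add: inverse_moment_def)
  then have "set_integrable lborel {0<..\<delta>} (\<lambda>s. 1 + enn2real (inverse_moment s))"
    using delta by (intro set_integral_add) (simp_all add: set_integrable_def)
  then show ?thesis
    by (simp add: smoothing_rate_def[abs_def])
qed

lemma has_expectation_smoothing_rate:
  assumes "0 < s"
  shows "has_bochner_integral M0 (\<lambda>\<omega>. 1 + T0 s \<omega> powr (- 1/2 - \<kappa>)) (smoothing_rate s)"
proof -
  have "has_bochner_integral M0 (\<lambda>\<omega>. T0 s \<omega> powr (- 1/2 - \<kappa>)) (enn2real (inverse_moment s))"
    using inverse_moment_finite[OF assms] unfolding inverse_moment_def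
    by (intro has_bochner_integral_nn_integral) (auto simp: ennreal_enn2real)
  moreover have "has_bochner_integral M0 (\<lambda>_. 1) (1 :: real)"
    by (simp add: has_bochner_integral_iff M0.prob_space)
  ultimately show ?thesis
    unfolding smoothing_rate_def by (rule has_bochner_integral_add[rotated])
qed

lemma smoothing_integral_nonneg: "0 \<le> smoothing_integral t"
  unfolding smoothing_integral_def set_lebesgue_integral_def
  using order_trans[OF zero_le_one smoothing_rate_ge_1] by (intro integral_nonneg_AE) simp

lemma smoothing_integral_step:
  "0 < h \<Longrightarrow> h \<le> s \<Longrightarrow> s \<le> \<delta> \<Longrightarrow> smoothing_integral (s - h) + h * smoothing_rate s \<le> smoothing_integral s"
  unfolding smoothing_integral_def
  by (rule set_integral_antimono_step[OF set_integrable_smoothing_rate smoothing_rate_antimono])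

lemma smoothing_integral_tendsto_0:
  assumes "0 < t"
  shows "(\<lambda>n. smoothing_integral (t / real (Suc n))) \<longlonglongrightarrow> 0"
proof -
  have "(\<lambda>n. t * inverse (real (Suc n))) \<longlonglongrightarrow> t * 0"
    by (intro tendsto_mult tendsto_const LIMSEQ_inverse_real_of_nat)
  then have "filterlim (\<lambda>n. t / real (Suc n)) (at_right 0) sequentially"
    using assms by (auto simp: filterlim_at divide_inverse)
  from filterlim_compose[OF set_integral_tendsto_0_at_right[OF set_integrable_smoothing_rate delta] this]
  show ?thesis by (simp add: smoothing_integral_def)
qed

lemma bounded_borel_noise_sg:
  fixes f :: "real ^ 'd::finite \<Rightarrow> real"
  assumes "0 < t" and f: "bounded_borel m f"
  shows "bounded_borel m (noise_sg t f)"
proof (rule bounded_borelI)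
  let ?\<nu> = "subord_law M0 T0 t :: (real ^ 'd) measure"
  interpret \<nu>: prob_space ?\<nu> by (rule prob_space_subord_law[OF T0_sub \<open>0 < t\<close>])
  note sets_\<nu> = sets_subord_law[OF T0_sub \<open>0 < t\<close>]
  note [measurable] = bounded_borel_measurable[OF f]
  have "(\<lambda>(x, w). f (x + w)) \<in> borel_measurable (borel \<Otimes>\<^sub>M ?\<nu>)"
    unfolding measurable_cong_sets[OF sets_pair_measure_cong[OF refl sets_\<nu>] refl] by measurable
  then show "noise_sg t f \<in> borel_measurable borel"
    unfolding noise_sg_def[abs_def] by (rule \<nu>.borel_measurable_lebesgue_integral)
  show "\<bar>noise_sg t f x\<bar> \<le> m" for x
    unfolding noise_sg_def
    by (rule \<nu>.abs_integral_bounded_borel_le[OF bounded_borel_shift[OF f] measurable_ident_sets[OF sets_\<nu>]])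
qed

lemma noise_sg_add:
  fixes f :: "real ^ 'd::finite \<Rightarrow> real"
  assumes pos: "0 < s" "0 < t" and f: "bounded_borel m f"
  shows "noise_sg (s + t) f x = noise_sg s (noise_sg t f) x"
proof -
  let ?\<nu> = "\<lambda>t. subord_law M0 T0 t :: (real ^ 'd) measure"
  interpret s: prob_space "?\<nu> s" by (rule prob_space_subord_law[OF T0_sub pos(1)])
  interpret t: prob_space "?\<nu> t" by (rule prob_space_subord_law[OF T0_sub pos(2)])
  interpret pair_prob_space "?\<nu> s" "?\<nu> t" ..
  have add_measurable: "(\<lambda>p. x + (fst p + snd p)) \<in> borel_measurable (?\<nu> s \<Otimes>\<^sub>M ?\<nu> t)" for x
    unfolding measurable_cong_sets[OF sets_pair_measure_cong[OF sets_subord_law[OF T0_sub pos(1)]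
          sets_subord_law[OF T0_sub pos(2)]] refl]
    by measurable
  note [measurable] = bounded_borel_measurable[OF f]
  have "noise_sg (s + t) f x = (\<integral> p. f (x + (fst p + snd p)) \<partial>(?\<nu> s \<Otimes>\<^sub>M ?\<nu> t))"
    unfolding noise_sg_def subord_law_add[OF T0_sub pos] convolution_def
    using add_measurable[of 0] by (subst integral_distr) (auto simp: split_beta')
  also have "\<dots> = (\<integral> y. \<integral> z. f (x + (y + z)) \<partial>?\<nu> t \<partial>?\<nu> s)"
    using integral_fst'[of "\<lambda>p. f (x + (fst p + snd p))"] integrable_bounded_borel[OF f add_measurable]
    by simp
  finally show ?thesis by (simp add: noise_sg_def add.assoc)
qed

lemma noise_sg_lipschitz:
  fixes f :: "real ^ 'd::finite \<Rightarrow> real"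
  assumes "0 < s" and f: "bounded_borel m f" and heat_f: "heat_bounded \<kappa> N f"
  shows "(4 * 2 powr (real CARD('d) / 2) * N * smoothing_rate s)-lipschitz_on UNIV (noise_sg s f)"
proof (rule lipschitz_onI)
  fix x y :: "real ^ 'd"
  let ?c = "4 * 2 powr (real CARD('d) / 2) * N"
  let ?G = "\<lambda>\<omega> u. \<integral> w. f (u + w) \<partial>gauss_vec (T0 s \<omega>)"
  note shift = bounded_borel_shift[OF f]
  note integrable_G = integrable_integral_gauss_vec_subordinator[OF T0_sub \<open>0 < s\<close> shift]
  note rate = has_expectation_smoothing_rate[OF \<open>0 < s\<close>, unfolded has_bochner_integral_iff]
  have pointwise: "\<bar>?G \<omega> x - ?G \<omega> y\<bar> \<le> ?c * dist x y * (1 + T0 s \<omega> powr (- 1/2 - \<kappa>))"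
    if "\<omega> \<in> space M0" for \<omega>
    using heat_bounded_lipschitz[OF bounded_borel_measurable[OF f] heat_f \<kappa>
          subordinator_pos[OF T0_sub \<open>0 < s\<close> that], THEN lipschitz_onD, of x y]
    by (simp add: dist_real_def mult_ac)
  have "\<bar>noise_sg s f x - noise_sg s f y\<bar> = \<bar>\<integral> \<omega>. ?G \<omega> x - ?G \<omega> y \<partial>M0\<bar>"
    using integrable_G by (simp add: noise_sg_def integral_subord_law[OF T0_sub \<open>0 < s\<close> shift])
  also have "\<dots> \<le> (\<integral> \<omega>. \<bar>?G \<omega> x - ?G \<omega> y\<bar> \<partial>M0)"
    by (rule integral_abs_bound)
  also have "\<dots> \<le> (\<integral> \<omega>. ?c * dist x y * (1 + T0 s \<omega> powr (- 1/2 - \<kappa>)) \<partial>M0)"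
    using integrable_G rate pointwise
    by (intro integral_mono integrable_abs Bochner_Integration.integrable_diff integrable_mult_right) auto
  also have "\<dots> = ?c * smoothing_rate s * dist x y"
    using rate by simp
  finally show "dist (noise_sg s f x) (noise_sg s f y) \<le> ?c * smoothing_rate s * dist x y"
    by (simp add: dist_real_def)
qed (use heat_bounded_nonneg[OF heat_f] smoothing_rate_ge_1[of s] in simp)

lemma noise_sg_le:
  fixes f :: "real ^ 'd::finite \<Rightarrow> real"
  assumes "0 < s" and [measurable]: "f \<in> borel_measurable borel" and heat_f: "heat_bounded \<kappa> N f"
  shows "\<bar>noise_sg s f x\<bar> \<le> 2 * N * smoothing_rate s"
proof -
  have "0 \<le> N" by (rule heat_bounded_nonneg[OF heat_f])
  have "ennreal \<bar>noise_sg s f x\<bar> \<le> (\<integral>\<^sup>+ w. ennreal \<bar>f (x + w)\<bar> \<partial>subord_law M0 T0 s)"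
  proof (cases "integrable (subord_law M0 T0 s) (\<lambda>w. f (x + w))")
    case True
    from integral_norm_bound_ennreal[OF this] show ?thesis by (simp add: noise_sg_def)
  qed (simp add: noise_sg_def not_integrable_integral_eq)
  also have "\<dots> = (\<integral>\<^sup>+ \<omega>. \<integral>\<^sup>+ w. ennreal \<bar>f (x + w)\<bar> \<partial>gauss_vec (T0 s \<omega>) \<partial>M0)"
    by (rule nn_integral_subord_law[OF T0_sub \<open>0 < s\<close>]) measurable
  also have "\<dots> \<le> (\<integral>\<^sup>+ \<omega>. ennreal (2 * N * (1 + T0 s \<omega> powr (- 1/2 - \<kappa>))) \<partial>M0)"
  proof (intro nn_integral_mono)
    fix \<omega> assume "\<omega> \<in> space M0"
    then have pos: "0 < T0 s \<omega>" by (rule subordinator_pos[OF T0_sub \<open>0 < s\<close>])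
    have "1 + T0 s \<omega> powr (- \<kappa>) \<le> 2 * (1 + T0 s \<omega> powr (- 1/2 - \<kappa>))"
      using powr_le_one_plus_powr[OF pos, of "- 1/2 - \<kappa>" "- \<kappa>"] \<kappa>
        powr_ge_zero[of "T0 s \<omega>" "- 1/2 - \<kappa>"] by argo
    from mult_left_mono[OF this \<open>0 \<le> N\<close>]
    have "N * (1 + T0 s \<omega> powr (- \<kappa>)) \<le> 2 * N * (1 + T0 s \<omega> powr (- 1/2 - \<kappa>))"
      by (simp only: mult_ac)
    then show "(\<integral>\<^sup>+ w. ennreal \<bar>f (x + w)\<bar> \<partial>gauss_vec (T0 s \<omega>))
        \<le> ennreal (2 * N * (1 + T0 s \<omega> powr (- 1/2 - \<kappa>)))"
      by (intro order_trans[OF heat_boundedD[OF heat_f pos]] ennreal_leI)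
  qed
  also have "\<dots> = ennreal (2 * N * smoothing_rate s)"
    using has_expectation_smoothing_rate[OF \<open>0 < s\<close>] \<open>0 \<le> N\<close>
    by (subst nn_integral_eq_integral) (auto simp: has_bochner_integral_iff)
  finally show ?thesis
    using \<open>0 \<le> N\<close> smoothing_rate_ge_1[of s] by (subst (asm) ennreal_le_iff) auto
qed

end

section \<open>The semigroup of the solution\<close>

locale subordinated_sde = subordinated_noise M0 T0 \<kappa> \<delta>
  for M0 :: "'b measure" and T0 :: "real \<Rightarrow> 'b \<Rightarrow> real" and \<kappa> \<delta> :: real +
  fixes b :: "real ^ 'd::finite \<Rightarrow> real ^ 'd" and B :: real
    and M :: "real ^ 'd \<Rightarrow> 'a measure"
    and W :: "real ^ 'd \<Rightarrow> real \<Rightarrow> 'a \<Rightarrow> real ^ 'd"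
    and T :: "real ^ 'd \<Rightarrow> real \<Rightarrow> 'a \<Rightarrow> real"
    and X :: "real ^ 'd \<Rightarrow> real \<Rightarrow> 'a \<Rightarrow> real ^ 'd"
  assumes b_le: "\<And>z. norm (b z) \<le> B"
    and W_wiener: "\<And>x. wiener_process (M x) (W x)"
    and T_sub: "\<And>x. subordinator (M x) (T x)"
    and T_law: "\<And>x. same_fdd (M x) (T x) M0 T0"
    and WT_indep: "\<And>x. prob_space.indep_set (M x) (proc_sigma (M x) (W x)) (proc_sigma (M x) (T x))"
    and X_meas [measurable]: "\<And>x t. X x t \<in> borel_measurable (M x)"
    and X_sol: "\<And>x. AE \<omega> in M x. \<forall>t\<ge>0.
          (\<lambda>s. b (X x s \<omega>)) integrable_on {0..t} \<and>
          X x t \<omega> = x + integral {0..t} (\<lambda>s. b (X x s \<omega>)) + W x (T x t \<omega>) \<omega>"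
    and X_markov: "\<And>x s t f. 0 \<le> s \<Longrightarrow> 0 \<le> t \<Longrightarrow> f \<in> borel_measurable borel \<Longrightarrow> bounded (range f) \<Longrightarrow>
          AE \<omega> in M x. real_cond_exp (M x) (nat_filtration (M x) (X x) s) (\<lambda>\<omega>. f (X x (s + t) \<omega>)) \<omega>
                         = trans_sg M X t f (X x s \<omega>)"
    and feller: "\<And>t f. 0 \<le> t \<Longrightarrow> continuous_on UNIV f \<Longrightarrow> bounded (range f) \<Longrightarrow>
          continuous_on UNIV (trans_sg M X t f)"
begin

sublocale M: prob_space "M x" for x using W_wiener[of x] by (simp add: wiener_process_def)

abbreviation sol_sg :: "real \<Rightarrow> (real ^ 'd \<Rightarrow> real) \<Rightarrow> real ^ 'd \<Rightarrow> real" where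
  "sol_sg \<equiv> trans_sg M X"

definition drift_const :: real where
  "drift_const = 4 * 2 powr (real CARD('d) / 2) * B"

lemma B_nonneg: "0 \<le> B"
  using b_le[of 0] norm_ge_zero order_trans by blast

lemma drift_const_nonneg: "0 \<le> drift_const"
  using B_nonneg by (simp add: drift_const_def)

lemma noise_sg_eq_expectation:
  assumes "0 < t" and [measurable]: "f \<in> borel_measurable borel"
  shows "noise_sg t f x = (\<integral> \<omega>. f (x + W x (T x t \<omega>) \<omega>) \<partial>M x)"
proof -
  note [measurable] = wiener_subordinated_measurable[OF W_wiener T_sub WT_indep \<open>0 < t\<close>, of x]
  have "distr (M x) borel (T x t) = distr M0 borel (T0 t)"
    using T_sub[of x] \<open>0 < t\<close> by (intro same_fdd_distr[OF T_law]) (auto simp: subordinator_def)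
  then have "subord_law M0 T0 t = distr (M x) borel (\<lambda>\<omega>. W x (T x t \<omega>) \<omega>)"
    by (simp add: distr_wiener_subordinated[OF W_wiener T_sub WT_indep \<open>0 < t\<close>]
        subord_law_cong[OF T_sub T0_sub _ \<open>0 < t\<close>])
  then show ?thesis
    by (simp add: noise_sg_def integral_distr)
qed

lemma sol_noise_diff_le_lipschitz_small_time:
  assumes "0 < h" and g: "bounded_borel m g" and lip: "L-lipschitz_on UNIV g"
  shows "\<bar>sol_sg h g x - noise_sg h g x\<bar> \<le> h * B * L"
proof -
  note [measurable] = bounded_borel_measurable[OF g]
    wiener_subordinated_measurable[OF W_wiener T_sub WT_indep \<open>0 < h\<close>, of x]
  have "AE \<omega> in M x. \<bar>g (X x h \<omega>) - g (x + W x (T x h \<omega>) \<omega>)\<bar> \<le> h * B * L"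
    using X_sol[of x]
  proof eventually_elim
    case (elim \<omega>)
    let ?drift = "integral {0..h} (\<lambda>s. b (X x s \<omega>))"
    have X_eq: "X x h \<omega> = x + ?drift + W x (T x h \<omega>) \<omega>"
      and "(\<lambda>s. b (X x s \<omega>)) integrable_on {0..h}"
      using elim \<open>0 < h\<close> by auto
    then have "((\<lambda>s. b (X x s \<omega>)) has_integral ?drift) (cbox 0 h)"
      by (simp add: has_integral_integral)
    from has_integral_bound[OF B_nonneg this] have "norm ?drift \<le> B * h"
      using b_le \<open>0 < h\<close> by simp
    then have "L * norm ?drift \<le> L * (B * h)"
      using lipschitz_on_nonneg[OF lip] by (rule mult_left_mono)
    then show ?case
      using lipschitz_onD[OF lip, of "X x h \<omega>" "x + W x (T x h \<omega>) \<omega>"]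
      by (simp add: X_eq dist_real_def dist_norm mult_ac)
  qed
  then show ?thesis
    unfolding trans_sg_def noise_sg_eq_expectation[OF \<open>0 < h\<close> bounded_borel_measurable[OF g]]
    by (intro M.abs_integral_diff_le M.integrable_bounded_borel[OF g]) auto
qed

text \<open>Stated with an approximation \<open>g\<close> because \<open>sol_sg t f\<close> is not known to be measurable
  before the strong Feller property is available.\<close>

lemma sol_sg_add_approx:
  assumes "0 \<le> s" "0 \<le> t" and f: "bounded_borel m f" and g: "bounded_borel m' g"
    and approx: "\<And>y. \<bar>sol_sg t f y - g y\<bar> \<le> K"
  shows "\<bar>sol_sg (s + t) f x - sol_sg s g x\<bar> \<le> K"
proof -
  let ?F = "nat_filtration (M x) (X x) s"
  have generators: "{X x r -` A \<inter> space (M x) | r A. 0 \<le> r \<and> r \<le> s \<and> A \<in> sets borel} \<subseteq> sets (M x)"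
    by auto
  have "subalgebra (M x) ?F"
    unfolding subalgebra_def nat_filtration_def
    using sets.sigma_sets_subset[OF generators] generators sets.space_closed[of "M x"]
    by (subst sets_measure_of) (auto intro: order_trans)
  then interpret finite_measure_subalgebra "M x" ?F
    by unfold_locales
  have integrable: "integrable (M x) (\<lambda>\<omega>. f (X x (s + t) \<omega>))" "integrable (M x) (\<lambda>\<omega>. g (X x s \<omega>))"
    by (rule M.integrable_bounded_borel[OF f X_meas]) (rule M.integrable_bounded_borel[OF g X_meas])
  from X_markov[OF \<open>0 \<le> s\<close> \<open>0 \<le> t\<close> bounded_borel_measurable[OF f] bounded_borel_bounded[OF f], of x]
  have "AE \<omega> in M x. \<bar>real_cond_exp (M x) ?F (\<lambda>\<omega>. f (X x (s + t) \<omega>)) \<omega> - g (X x s \<omega>)\<bar> \<le> K"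
    by eventually_elim (simp add: approx)
  from M.abs_integral_diff_le[OF real_cond_exp_int(1)[OF integrable(1)] integrable(2) this]
  show ?thesis
    by (simp add: trans_sg_def real_cond_exp_int(2)[OF integrable(1)])
qed

text \<open>One step of length \<open>h\<close> costs \<open>h * B\<close> times the Lipschitz constant of \<open>noise_sg s f\<close>. As the smoothing
  rate is decreasing, the costs add up to at most its integral.\<close>

lemma sol_noise_diff_le_iterate:
  assumes f: "bounded_borel m f" and heat_f: "heat_bounded \<kappa> N f" and "0 < h"
    and start: "\<And>x. \<bar>sol_sg h f x - noise_sg h f x\<bar> \<le> r"
  shows "real (Suc n) * h \<le> \<delta> \<Longrightarrow> \<bar>sol_sg (real (Suc n) * h) f x - noise_sg (real (Suc n) * h) f x\<bar>
    \<le> r + drift_const * N * smoothing_integral (real n * h)"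
proof (induction n arbitrary: x)
  case 0
  then show ?case
    using start by (simp add: smoothing_integral_def set_lebesgue_integral_def)
next
  case (Suc n)
  define s where "s = real (Suc n) * h"
  have s: "0 < s" "h \<le> s" using \<open>0 < h\<close> by (simp_all add: s_def)
  have time_add: "real (Suc (Suc n)) * h = h + s" by (simp add: s_def algebra_simps)
  have "s \<le> \<delta>" using Suc.prems \<open>0 < h\<close> unfolding time_add by simp
  have "\<bar>sol_sg s f y - noise_sg s f y\<bar> \<le> r + drift_const * N * smoothing_integral (s - h)" for y
    using Suc.IH[of y] \<open>s \<le> \<delta>\<close> by (simp add: s_def algebra_simps)
  then have "\<bar>sol_sg (h + s) f x - sol_sg h (noise_sg s f) x\<bar>
      \<le> r + drift_const * N * smoothing_integral (s - h)"
    using \<open>0 < h\<close> s by (intro sol_sg_add_approx[OF _ _ f bounded_borel_noise_sg[OF _ f]]) auto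
  moreover have "\<bar>sol_sg h (noise_sg s f) x - noise_sg h (noise_sg s f) x\<bar>
      \<le> drift_const * N * (h * smoothing_rate s)"
    using sol_noise_diff_le_lipschitz_small_time[OF \<open>0 < h\<close> bounded_borel_noise_sg[OF s(1) f]
        noise_sg_lipschitz[OF s(1) f heat_f], of x]
    by (simp add: drift_const_def mult_ac)
  moreover have "drift_const * N * (smoothing_integral (s - h) + h * smoothing_rate s)
      \<le> drift_const * N * smoothing_integral s"
    using drift_const_nonneg heat_bounded_nonneg[OF heat_f] smoothing_integral_step[OF \<open>0 < h\<close> s(2) \<open>s \<le> \<delta>\<close>]
    by (intro mult_left_mono) auto
  ultimately have "\<bar>sol_sg (h + s) f x - noise_sg (h + s) f x\<bar> \<le> r + drift_const * N * smoothing_integral s"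
    unfolding noise_sg_add[OF \<open>0 < h\<close> s(1) f] distrib_left by linarith
  then show ?case unfolding time_add s_def .
qed

lemma sol_noise_diff_le_of_vanishing_start:
  assumes f: "bounded_borel m f" and heat_f: "heat_bounded \<kappa> N f" and t: "0 < t" "t \<le> \<delta>"
    and start: "\<And>n x. \<bar>sol_sg (t / real (Suc n)) f x - noise_sg (t / real (Suc n)) f x\<bar> \<le> r n"
    and r: "r \<longlonglongrightarrow> 0"
  shows "\<bar>sol_sg t f x - noise_sg t f x\<bar> \<le> drift_const * N * smoothing_integral t"
proof (rule LIMSEQ_le_const)
  show "(\<lambda>n. r n + drift_const * N * smoothing_integral t) \<longlonglongrightarrow> drift_const * N * smoothing_integral t"
    using tendsto_add[OF r tendsto_const] by simp
  have "\<bar>sol_sg t f x - noise_sg t f x\<bar> \<le> r n + drift_const * N * smoothing_integral t" for n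
  proof -
    define h where "h = t / real (Suc n)"
    have h: "0 < h" "h \<le> t" and n_h: "real (Suc n) * h = t" "real n * h = t - h"
      using t by (auto simp: h_def divide_simps algebra_simps)
    have "\<bar>sol_sg t f x - noise_sg t f x\<bar> \<le> r n + drift_const * N * smoothing_integral (t - h)"
      using sol_noise_diff_le_iterate[OF f heat_f h(1), of "r n" n x] start[of n] t
      unfolding n_h by (simp add: h_def)
    also have "smoothing_integral (t - h) \<le> smoothing_integral t"
      using smoothing_integral_step[OF h t(2)] smoothing_rate_ge_1[of t] h(1)
        mult_nonneg_nonneg[of h "smoothing_rate t"] by linarith
    finally show ?thesis
      using drift_const_nonneg heat_bounded_nonneg[OF heat_f] by (simp add: mult_left_mono)
  qed
  then show "\<exists>k. \<forall>n\<ge>k. \<bar>sol_sg t f x - noise_sg t f x\<bar> \<le> r n + drift_const * N * smoothing_integral t"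
    by blast
qed

lemma sol_noise_diff_le_lipschitz:
  assumes f: "bounded_borel m f" and lip: "L-lipschitz_on UNIV f" and t: "0 < t" "t \<le> \<delta>"
  shows "\<bar>sol_sg t f x - noise_sg t f x\<bar> \<le> drift_const * m * smoothing_integral t"
proof (rule sol_noise_diff_le_of_vanishing_start[OF f heat_bounded_bounded_borel[OF f] t])
  show "\<bar>sol_sg (t / real (Suc n)) f x - noise_sg (t / real (Suc n)) f x\<bar>
      \<le> t * B * L * inverse (real (Suc n))" for n x
    using sol_noise_diff_le_lipschitz_small_time[OF _ f lip, of "t / real (Suc n)" x] t
    by (simp add: divide_inverse mult_ac)
  show "(\<lambda>n. t * B * L * inverse (real (Suc n))) \<longlonglongrightarrow> 0"
    using tendsto_mult[OF tendsto_const LIMSEQ_inverse_real_of_nat] by simp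
qed

lemma sol_noise_diff_le_bounded:
  assumes f: "bounded_borel m f" and t: "0 < t" "t \<le> \<delta>"
  shows "\<bar>sol_sg t f x - noise_sg t f x\<bar> \<le> 2 * m * (drift_const * smoothing_integral t)"
proof -
  let ?\<mu> = "distr (M x) borel (X x t)"
  let ?\<rho> = "distr (M x) borel (\<lambda>\<omega>. x + W x (T x t \<omega>) \<omega>)"
  note [measurable] = wiener_subordinated_measurable[OF W_wiener T_sub WT_indep t(1), of x]
  have integral_eq: "(\<integral> y. g y \<partial>?\<mu>) = sol_sg t g x" "(\<integral> y. g y \<partial>?\<rho>) = noise_sg t g x"
    if "g \<in> borel_measurable borel" for g
    using that by (simp_all add: integral_distr trans_sg_def noise_sg_eq_expectation[OF t(1)])
  have "\<bar>(\<integral> y. f y \<partial>?\<mu>) - (\<integral> y. f y \<partial>?\<rho>)\<bar> \<le> 2 * m * (drift_const * smoothing_integral t)"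
  proof (rule lipschitz_test_imp_abs_integral_diff_le[OF _ _ _ _ _ f])
    show "prob_space ?\<mu>" "prob_space ?\<rho>" by (auto intro: M.prob_space_distr)
    fix g :: "real ^ 'd \<Rightarrow> real" and L
    assume lip: "L-lipschitz_on UNIV g" and g: "\<And>x. \<bar>g x\<bar> \<le> 1"
    from bounded_borelI[OF lipschitz_on_borel_measurable[OF lip] g]
    have "\<bar>sol_sg t g x - noise_sg t g x\<bar> \<le> drift_const * 1 * smoothing_integral t"
      by (rule sol_noise_diff_le_lipschitz[OF _ lip t])
    then show "(\<integral> y. g y \<partial>?\<mu>) \<le> (\<integral> y. g y \<partial>?\<rho>) + drift_const * smoothing_integral t"
      by (simp add: integral_eq lipschitz_on_borel_measurable[OF lip] abs_le_iff)
  qed simp_all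
  then show ?thesis by (simp add: integral_eq bounded_borel_measurable[OF f])
qed

lemma bounded_error_tendsto_0:
  "0 < t \<Longrightarrow> (\<lambda>n. 2 * m * (drift_const * smoothing_integral (t / real (Suc n)))) \<longlonglongrightarrow> 0"
  using tendsto_mult_left[OF smoothing_integral_tendsto_0, of t "2 * m * drift_const"] by (simp add: mult.assoc)

lemma strong_feller:
  assumes f: "bounded_borel m f" and "0 < t"
  shows "continuous_on UNIV (sol_sg t f)"
proof (rule continuous_on_uniform_approx)
  define u where "u = min t \<delta>"
  define s where "s n = u / real (Suc n)" for n
  have "0 < u" using \<open>0 < t\<close> delta by (simp add: u_def)
  then have s: "0 < s n" "s n \<le> t" "s n \<le> \<delta>" for n
    using divide_left_mono[of 1 "real (Suc n)" u] by (auto simp: s_def u_def)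
  show "(\<lambda>n. 2 * m * (drift_const * smoothing_integral (s n))) \<longlonglongrightarrow> 0"
    unfolding s_def by (rule bounded_error_tendsto_0[OF \<open>0 < u\<close>])
  show "continuous_on UNIV (sol_sg (t - s n) (noise_sg (s n) f))" for n
    using s[of n] noise_sg_lipschitz[OF s(1) f heat_bounded_bounded_borel[OF f]]
    by (intro feller bounded_borel_bounded[OF bounded_borel_noise_sg[OF s(1) f]])
      (auto intro: lipschitz_on_continuous_on)
  show "dist (sol_sg t f x) (sol_sg (t - s n) (noise_sg (s n) f) x)
      \<le> 2 * m * (drift_const * smoothing_integral (s n))" for n x
    using sol_sg_add_approx[OF _ _ f bounded_borel_noise_sg[OF s(1) f] sol_noise_diff_le_bounded[OF f s(1,3)],
        of "t - s n" n] s[of n]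
    by (simp add: dist_real_def)
qed

lemma sol_noise_diff_le_heat_bounded:
  assumes f: "bounded_borel m f" and heat_f: "heat_bounded \<kappa> N f" and t: "0 < t" "t \<le> \<delta>"
  shows "\<bar>sol_sg t f x - noise_sg t f x\<bar> \<le> drift_const * N * smoothing_integral t"
proof (rule sol_noise_diff_le_of_vanishing_start[OF f heat_f t _ bounded_error_tendsto_0[OF t(1)]])
  show "\<bar>sol_sg (t / real (Suc n)) f x - noise_sg (t / real (Suc n)) f x\<bar>
      \<le> 2 * m * (drift_const * smoothing_integral (t / real (Suc n)))" for n x
    using t divide_left_mono[of 1 "real (Suc n)" t] by (intro sol_noise_diff_le_bounded[OF f]) auto
qed

definition sol_bound :: "real \<Rightarrow> real" where
  "sol_bound t = 2 * smoothing_rate (min t \<delta>) + drift_const * smoothing_integral (min t \<delta>)"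

lemma sol_bound_nonneg: "0 \<le> sol_bound t"
  using smoothing_rate_ge_1[of "min t \<delta>"] drift_const_nonneg smoothing_integral_nonneg
  by (simp add: sol_bound_def)

lemma sol_sg_le:
  assumes f: "bounded_borel m f" and heat_f: "heat_bounded \<kappa> N f" and "0 < t"
  shows "\<bar>sol_sg t f x\<bar> \<le> sol_bound t * N"
proof -
  define u where "u = min t \<delta>"
  have u: "0 < u" "u \<le> t" "u \<le> \<delta>" using \<open>0 < t\<close> delta by (auto simp: u_def)
  have "\<bar>sol_sg u f y - 0\<bar> \<le> sol_bound t * N" for y
    using sol_noise_diff_le_heat_bounded[OF f heat_f u(1,3), of y]
      noise_sg_le[OF u(1) bounded_borel_measurable[OF f] heat_f, of y]
    by (simp add: sol_bound_def u_def[symmetric] algebra_simps)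
  then have "\<bar>sol_sg ((t - u) + u) f x - sol_sg (t - u) (\<lambda>_. 0) x\<bar> \<le> sol_bound t * N"
    using u by (intro sol_sg_add_approx[OF _ _ f, where m' = 0]) (auto simp: bounded_borel_def)
  then show ?thesis by (simp add: trans_sg_def)
qed

lemma nn_integral_sol_le:
  assumes f [measurable]: "f \<in> borel_measurable borel" and heat_f: "heat_bounded \<kappa> N f" and "0 < t"
  shows "(\<integral>\<^sup>+ \<omega>. ennreal \<bar>f (X x t \<omega>)\<bar> \<partial>M x) \<le> ennreal (sol_bound t * N)"
proof -
  define g where "g n y = min \<bar>f y\<bar> (real n)" for n y
  have [measurable]: "g n \<in> borel_measurable borel" for n unfolding g_def by measurable
  have g: "bounded_borel (real n) (g n)" for n
    by (rule bounded_borelI, measurable) (auto simp: g_def)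
  have g_nonneg: "0 \<le> g n y" for n y by (simp add: g_def)
  have heat_g: "heat_bounded \<kappa> N (g n)" for n
    by (rule heat_bounded_mono_AE[OF heat_f f], measurable) (simp add: g_def)
  have "(\<integral>\<^sup>+ \<omega>. ennreal \<bar>f (X x t \<omega>)\<bar> \<partial>M x) = (\<integral>\<^sup>+ \<omega>. (SUP n. ennreal (g n (X x t \<omega>))) \<partial>M x)"
    by (simp add: g_def SUP_ennreal_min_of_nat)
  also have "\<dots> = (SUP n. \<integral>\<^sup>+ \<omega>. ennreal (g n (X x t \<omega>)) \<partial>M x)"
    by (intro nn_integral_monotone_convergence_SUP)
      (auto intro!: ennreal_leI simp: incseq_def le_fun_def g_def min_def)
  also have "\<dots> \<le> ennreal (sol_bound t * N)"
  proof (rule SUP_least)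
    fix n
    have "(\<integral>\<^sup>+ \<omega>. ennreal (g n (X x t \<omega>)) \<partial>M x) = ennreal (sol_sg t (g n) x)"
      unfolding trans_sg_def using g_nonneg
      by (intro nn_integral_eq_integral M.integrable_bounded_borel[OF g]) auto
    also have "\<dots> \<le> ennreal (sol_bound t * N)"
      using sol_sg_le[OF g heat_g \<open>0 < t\<close>, of n x] by (intro ennreal_leI) simp
    finally show "(\<integral>\<^sup>+ \<omega>. ennreal (g n (X x t \<omega>)) \<partial>M x) \<le> ennreal (sol_bound t * N)" .
  qed
  finally show ?thesis .
qed

lemma integrable_sol:
  assumes f [measurable]: "f \<in> borel_measurable borel" and heat_f: "heat_bounded \<kappa> N f" and "0 < t"
  shows "integrable (M x) (\<lambda>\<omega>. f (X x t \<omega>))"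
  using order_le_less_trans[OF nn_integral_sol_le[OF assms, of x] ennreal_less_top]
  by (intro integrableI_bounded) simp_all

lemma sol_sg_diff_le:
  assumes f: "f \<in> borel_measurable borel" "heat_bounded \<kappa> N f"
    and g: "g \<in> borel_measurable borel" "heat_bounded \<kappa> N' g"
    and heat_diff: "heat_bounded \<kappa> K (\<lambda>y. f y - g y)" and "0 < t"
  shows "\<bar>sol_sg t f x - sol_sg t g x\<bar> \<le> sol_bound t * K"
proof -
  note integrable_fg = integrable_sol[OF f \<open>0 < t\<close>, of x] integrable_sol[OF g \<open>0 < t\<close>, of x]
  have "ennreal \<bar>sol_sg t f x - sol_sg t g x\<bar> = ennreal (norm (\<integral> \<omega>. f (X x t \<omega>) - g (X x t \<omega>) \<partial>M x))"
    using integrable_fg by (simp add: trans_sg_def)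
  also have "\<dots> \<le> (\<integral>\<^sup>+ \<omega>. ennreal (norm (f (X x t \<omega>) - g (X x t \<omega>))) \<partial>M x)"
    using integrable_fg by (intro integral_norm_bound_ennreal) auto
  also have "\<dots> \<le> ennreal (sol_bound t * K)"
    using nn_integral_sol_le[OF borel_measurable_diff[OF f(1) g(1)] heat_diff \<open>0 < t\<close>, of x] by simp
  finally show ?thesis
    using sol_bound_nonneg heat_bounded_nonneg[OF heat_diff] by (subst (asm) ennreal_le_iff) auto
qed

lemma
  assumes f: "heat_regular \<kappa> f" and "0 < t"
  shows heat_regular_integrable_sol: "integrable (M x) (\<lambda>\<omega>. f (X x t \<omega>))"
    and heat_regular_continuous_sol_sg: "continuous_on UNIV (sol_sg t f)"
    and heat_regular_bounded_sol_sg: "bounded (range (sol_sg t f))"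
proof -
  obtain N where N: "N \<longlonglongrightarrow> 0" and tail: "\<And>n. heat_bounded \<kappa> (N n) (\<lambda>y. max 0 (\<bar>f y\<bar> - real n))"
    and [measurable]: "f \<in> borel_measurable borel"
    using f by (auto simp: heat_regular_def)
  have heat_f: "heat_bounded \<kappa> (N 0) f"
    using tail[of 0] by (simp add: heat_bounded_def max_def)
  show "integrable (M x) (\<lambda>\<omega>. f (X x t \<omega>))"
    by (rule integrable_sol[OF _ heat_f \<open>0 < t\<close>]) simp
  have "\<bar>sol_sg t f x - sol_sg t (\<lambda>_. 0) x\<bar> \<le> sol_bound t * N 0" for x
    using heat_f heat_bounded_const[of 0] by (intro sol_sg_diff_le[OF _ heat_f _ _ _ \<open>0 < t\<close>]) simp_all
  then show "bounded (range (sol_sg t f))"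
    by (auto simp: bounded_iff trans_sg_def)
  define g where "g n y = max (- real n) (min (f y) (real n))" for n y
  have [measurable]: "g n \<in> borel_measurable borel" for n unfolding g_def by measurable
  have g: "bounded_borel (real n) (g n)" for n
    by (rule bounded_borelI, measurable) (auto simp: g_def)
  have "heat_bounded \<kappa> (N n) (\<lambda>y. f y - g n y)" for n
    by (rule heat_bounded_mono_AE[OF tail], measurable) (auto simp: g_def)
  then have "dist (sol_sg t f x) (sol_sg t (g n) x) \<le> sol_bound t * N n" for n x
    unfolding dist_real_def using \<open>0 < t\<close>
    by (intro sol_sg_diff_le[OF _ heat_f _ heat_bounded_bounded_borel[OF g]]) simp_all
  moreover have "(\<lambda>n. sol_bound t * N n) \<longlonglongrightarrow> 0"
    using tendsto_mult_left[OF N] by simp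
  ultimately show "continuous_on UNIV (sol_sg t f)"
    by (intro continuous_on_uniform_approx[OF strong_feller[OF g \<open>0 < t\<close>]])
qed

end

theorem theorem4p2:
  fixes p :: ennreal
    and b :: "real ^ 'd::finite \<Rightarrow> real ^ 'd"
    and \<delta> :: real
    and M0 :: "'b measure" and T0 :: "real \<Rightarrow> 'b \<Rightarrow> real"
    and M :: "real ^ 'd \<Rightarrow> 'a measure"
    and W :: "real ^ 'd \<Rightarrow> real \<Rightarrow> 'a \<Rightarrow> real ^ 'd"
    and T :: "real ^ 'd \<Rightarrow> real \<Rightarrow> 'a \<Rightarrow> real"
    and X :: "real ^ 'd \<Rightarrow> real \<Rightarrow> 'a \<Rightarrow> real ^ 'd"
  assumes p: "1 \<le> p"
    and b_cont: "continuous_on UNIV b" and b_bdd: "bounded (range b)"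
    and T0_sub: "subordinator M0 T0"
    and W_wiener: "\<And>x. wiener_process (M x) (W x)"
    and T_sub: "\<And>x. subordinator (M x) (T x)"
    and T_law: "\<And>x. same_fdd (M x) (T x) M0 T0"
    and WT_indep: "\<And>x. prob_space.indep_set (M x)
          (proc_sigma (M x) (W x)) (proc_sigma (M x) (T x))"
    and X_meas: "\<And>x t. X x t \<in> borel_measurable (M x)"
    and X_sol: "\<And>x. AE \<omega> in M x. \<forall>t\<ge>0.
          (\<lambda>s. b (X x s \<omega>)) integrable_on {0..t} \<and>
          X x t \<omega> = x + integral {0..t} (\<lambda>s. b (X x s \<omega>)) + W x (T x t \<omega>) \<omega>"
    and X_markov: "\<And>x s t f. 0 \<le> s \<Longrightarrow> 0 \<le> t \<Longrightarrow> f \<in> borel_measurable borel \<Longrightarrow>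
          bounded (range f) \<Longrightarrow>
          AE \<omega> in M x. real_cond_exp (M x) (nat_filtration (M x) (X x) s) (\<lambda>\<omega>. f (X x (s + t) \<omega>)) \<omega>
                         = trans_sg M X t f (X x s \<omega>)"
    and feller: "\<And>t f. 0 \<le> t \<Longrightarrow> continuous_on UNIV f \<Longrightarrow> bounded (range f) \<Longrightarrow>
          continuous_on UNIV (trans_sg M X t f)"
    and delta: "\<delta> > 0"
    and integ: "(\<integral>\<^sup>+ s. indicator {0<..\<delta>} s *
          (\<integral>\<^sup>+ \<omega>. ennreal (T0 s \<omega> powr (- 1/2 - d_over_p CARD('d) p / 2)) \<partial>M0) \<partial>lborel) < \<top>"
  shows "\<forall>t>0. \<forall>f. Lp_fun p f \<longrightarrow>
           (\<forall>x. integrable (M x) (\<lambda>\<omega>. f (X x t \<omega>))) \<and>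
           continuous_on UNIV (trans_sg M X t f) \<and> bounded (range (trans_sg M X t f))"
proof -
  obtain B where B: "\<And>z. norm (b z) \<le> B" using b_bdd by (auto simp: bounded_iff)
  have \<kappa>: "0 \<le> d_over_p CARD('d) p / 2" by (simp add: d_over_p_def)
  interpret subordinated_sde M0 T0 "d_over_p CARD('d) p / 2" \<delta> b B M W T X
    by unfold_locales (fact \<kappa> B T0_sub W_wiener T_sub T_law WT_indep X_meas X_sol X_markov feller delta integ)+
  show ?thesis
    using Lp_fun_heat_regular[OF p] heat_regular_integrable_sol heat_regular_continuous_sol_sg
      heat_regular_bounded_sol_sg by blast
qed

end
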